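(* Let $k \geq 12$ be an integer with $k \equiv 0 \pmod 4$, and let $z_k$ be the zero of $E_k$ in $\mathbb{F}$ with the largest imaginary part. Then $1/\mathrm{E}_k(q) = \sum_{n=0}^\infty \beta_k(n) q^n$ has radius of convergence $|q_{z_k}|$, and \[ \beta_k(n)\, q_{z_k}^n + \frac{1}{\Theta(\mathrm{E}_k)(q_{z_k})} + \frac{1}{\Theta(\mathrm{E}_k)(\overline{q}_{z_k})}\left(\frac{q_{z_k}}{\overline{q}_{z_k}}\right)^n \] tends to $0$ as $n \to \infty$.
   Context: For an even integer $k \geq 4$, $B_k$ is the $k$-th Bernoulli number, $\sigma_\ell(n)=\sum_{d\mid n}d^\ell$, and $\mathrm{E}_k(q) = 1 - \frac{2k}{B_k}\sum_{n\ge1}\sigma_{k-1}(n)q^n$; the Eisenstein series is $E_k(z) = \mathrm{E}_k(q_z)$ with $q_z = e^{2\pi i z}$ for $z$ in the upper half plane $\mathbb{H}$. $\beta_k(n)$ are the coefficients of the expansion of $1/\mathrm{E}_k(q)$ around $q=0$. The standard fundamental domain is $\mathbb{F} = \{z\in\mathbb{H} : |z|\ge 1,\ 0 \le \mathrm{Re}(z) \le 1/2\} \cup \{z \in \mathbb{H}: |z|>1,\ -1/2 < \mathrm{Re}(z) < 0\}$. $\overline{q}_{z_k}$ denotes the complex conjugate of $q_{z_k}$. $\Theta = q\frac{\mathrm d}{\mathrm dq}$ acts on power series by $\Theta(\sum a(n)q^n) = \sum n a(n) q^n$, and $\Theta(\mathrm{E}_k)(w)$ denotes the value of this power series at $q =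 w$. *)

theory Defs
  imports "HOL-Analysis.Analysis"
begin

text \<open>
  The Bernoulli numbers, with exponential generating function \<open>x / (exp x - 1)\<close>.
  The convention for \<open>B\<^sub>1\<close> (here \<open>-1/2\<close>) is immaterial below.
\<close>

definition bernoulli :: "nat \<Rightarrow> real" where
  "bernoulli n = fact n * fps_nth (fps_X / (fps_exp 1 - 1)) n"

definition divisor_sigma :: "nat \<Rightarrow> nat \<Rightarrow> nat" where
  "divisor_sigma l n = (\<Sum>d | d dvd n. d ^ l)"

definition eisenstein_fps :: "nat \<Rightarrow> complex fps" where
  "eisenstein_fps k = Abs_fps (\<lambda>n. if n = 0 then 1
     else - of_real (2 * real k / bernoulli k) * of_nat (divisor_sigma (k - 1) n))"

definition nome :: "complex \<Rightarrow> complex" where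
  "nome z = exp (2 * of_real pi * \<i> * z)"

definition eisenstein_E :: "nat \<Rightarrow> complex \<Rightarrow> complex" where
  "eisenstein_E k z = eval_fps (eisenstein_fps k) (nome z)"

definition std_fund_domain :: "complex set" where
  "std_fund_domain =
     {z. Im z > 0 \<and> norm z \<ge> 1 \<and> 0 \<le> Re z \<and> Re z \<le> 1 / 2} \<union>
     {z. Im z > 0 \<and> norm z > 1 \<and> - 1 / 2 < Re z \<and> Re z < 0}"

definition beta_coeff :: "nat \<Rightarrow> nat \<Rightarrow> complex" where
  "beta_coeff k n = fps_nth (inverse (eisenstein_fps k)) n"

text \<open>
  The operator \<open>\<Theta> = q d/dq\<close> is \<^const>\<open>fps_XD\<close>: the coefficient of \<open>fps_XD f\<close> at \<open>n\<close>
  is \<open>n\<close> times that of \<open>f\<close>.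
\<close>

definition theta_eisenstein :: "nat \<Rightarrow> complex \<Rightarrow> complex" where
  "theta_eisenstein k w = eval_fps (fps_XD (eisenstein_fps k)) w"

end

theory Submission
  imports Defs "HOL-Complex_Analysis.Complex_Analysis"
begin

text \<open>
  Write \<open>k = 4n\<close> and let \<open>\<zeta>(k) Q(z)\<close> be the sum of \<open>1/(cz + d)^k + 1/(cz - d)^k\<close> over \<open>c, d \<ge> 1\<close>.
  The Lipschitz formula (the differentiated reflection formula of the digamma function) gives
  \<open>E\<^sub>k(z) = 1 + 1/z^k + Q(z)\<close>. Since \<open>|cz \<plusminus> d|\<^sup>2 \<ge> 2cd(|z| \<plusminus> Re z)\<close>, the term \<open>Q\<close> is small when
  \<open>|z| \<ge> 1\<close> and \<open>|Re z| \<le> 0.47 |z|\<close>. With \<open>z = \<i> exp(-\<i>u/(2n))\<close> the function \<open>T(u) = exp(-\<i>u) E\<^sub>k(z)\<close> is therefore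
  close to \<open>2 cos u\<close>, and it is real for real \<open>u\<close>. The intermediate value theorem yields a zero of \<open>T\<close> in
  \<open>(0, 2\<pi>/3)\<close>, hence a zero of \<open>E\<^sub>k\<close> on the unit arc close to \<open>\<i>\<close>. Every zero of \<open>E\<^sub>k\<close> in the
  right half of the fundamental domain that is at least as high has \<open>u\<close> in the strip
  \<open>|Re u - \<pi>/2| \<le> 0.43\<close>, where \<open>T\<close> is injective with nonvanishing derivative. So no valence formula
  is needed: the highest zero is simple and unique up to the reflection \<open>z \<mapsto> -cnj z\<close>, and
  \<open>1/E\<^sub>k(q)\<close> has exactly two poles, both simple, in the closed disc of radius \<open>|q|\<close> for this zero.
  Subtracting their principal parts gives the asymptotics; the two exponentials cannot cancel,
  which gives the radius of convergence.
\<close>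

section \<open>Eisenstein series as lattice sums\<close>


text \<open>Off the integers \<open>Gamma w * Gamma (1 - w) * sin (pi * w)\<close> is constantly pi.
  Its derivative \<open>D\<close> therefore vanishes, and the nonzero factors cancel.\<close>

lemma Digamma_reflection_complex:
  fixes z :: complex
  assumes "z \<notin> \<int>"
  shows "Digamma z - Digamma (1 - z) = - of_real pi * cot (of_real pi * z)"
proof -
  have z1: "1 - z \<notin> \<int>"
  proof
    assume "1 - z \<in> \<int>"
    hence "1 - (1 - z) \<in> \<int>" by (intro Ints_diff) auto
    with assms show False by simp
  qed
  have np: "z \<notin> \<int>\<^sub>\<le>\<^sub>0" "1 - z \<notin> \<int>\<^sub>\<le>\<^sub>0"
    using assms z1 nonpos_Ints_Int by blast+
  define D where "D = Gamma z * Gamma (1 - z) *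
     ((Digamma z - Digamma (1 - z)) * sin (of_real pi * z) + of_real pi * cos (of_real pi * z))"
  have "((\<lambda>w. Gamma w * Gamma (1 - w) * sin (of_real pi * w)) has_field_derivative D) (at z)"
    unfolding D_def using np
    by (auto intro!: derivative_eq_intros simp: algebra_simps)
  moreover have "((\<lambda>w. Gamma w * Gamma (1 - w) * sin (of_real pi * w)) has_field_derivative 0) (at z)"
  proof (rule has_field_derivative_transform_within_open[where S = "- \<int>"])
    show "((\<lambda>_. of_real pi) has_field_derivative 0) (at z :: complex filter)" by simp
    show "of_real pi = Gamma w * Gamma (1 - w) * sin (of_real pi * w)" if "w \<in> - \<int>" for w :: complex
    proof -
      have "sin (of_real pi * w) \<noteq> 0"
        using that by (auto simp: sin_eq_0 mult.commute)
      thus ?thesis by (simp add: Gamma_reflection_complex)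
    qed
  qed (use assms in \<open>auto simp: closed_Ints open_Compl\<close>)
  ultimately have "D = 0" by (rule DERIV_unique)
  moreover have "sin (of_real pi * z) \<noteq> 0"
    using assms by (auto simp: sin_eq_0 mult.commute)
  ultimately show ?thesis using np
    unfolding D_def by (auto simp: Gamma_eq_zero_iff cot_def divide_simps add_eq_0_iff)
qed

lemma norm_nome: "norm (nome z) = exp (- 2 * pi * Im z)"
  by (simp add: nome_def norm_exp_eq_Re)

lemma norm_nome_less_1: "Im z > 0 \<Longrightarrow> norm (nome z) < 1"
  by (simp add: norm_nome)

lemma has_field_derivative_nome:
  "(nome has_field_derivative 2 * of_real pi * \<i> * nome z) (at z within A)"
  unfolding nome_def by (auto intro!: derivative_eq_intros)

lemma fps_conv_radius_XD:
  fixes F :: "complex fps"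
  shows "fps_conv_radius (fps_XD F) \<ge> fps_conv_radius F"
proof -
  have "fps_conv_radius (fps_X * fps_deriv F) \<ge> min \<infinity> (fps_conv_radius (fps_deriv F))"
    using fps_conv_radius_mult[of fps_X "fps_deriv F"] by simp
  with fps_conv_radius_deriv[of F] show ?thesis
    by (simp add: fps_XD_def)
qed

text \<open>Under \<open>q = nome z\<close> the operator \<open>q d/dq\<close> is
  \<open>d/dz\<close> divided by \<open>2 pi i\<close>. This drives the polygamma induction and
  later links derivatives in z to \<open>theta_eisenstein\<close>.\<close>

lemma has_field_derivative_eval_fps_nome:
  assumes "ereal (norm (nome z)) < fps_conv_radius F"
  shows "((\<lambda>z. eval_fps F (nome z)) has_field_derivative
            2 * of_real pi * \<i> * eval_fps (fps_XD F) (nome z)) (at z)"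
proof -
  have "eval_fps (fps_XD F) (nome z) = nome z * eval_fps (fps_deriv F) (nome z)"
    using assms fps_conv_radius_deriv[of F]
    by (simp add: fps_XD_def eval_fps_mult less_le_trans)
  thus ?thesis
    using DERIV_chain2[OF has_field_derivative_eval_fps[OF assms] has_field_derivative_nome]
    by (simp add: mult_ac)
qed

text \<open>The coefficient \<open>1/2\<close> at 0 is the one in \<open>- \<pi> cot \<pi>z = 2\<pi>\<i> (1/2 + q + q\<^sup>2 + \<dots>)\<close>; it vanishes after
  one differentiation.\<close>
definition power_fps :: "nat \<Rightarrow> complex fps" where
  "power_fps n = (fps_XD ^^ n) (Abs_fps (\<lambda>m. if m = 0 then 1 / 2 else 1))"

lemma power_fps_nth: "fps_nth (power_fps n) m = of_nat m ^ n * (if m = 0 then 1 / 2 else 1)"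
  by (simp add: power_fps_def fps_mult_fps_XD_shift)

lemma eval_power_fps_0:
  assumes "norm q < 1"
  shows "eval_fps (power_fps 0) q = 1 / (1 - q) - 1 / 2"
proof -
  have "(\<lambda>m. q ^ m - (if m = 0 then 1 / 2 else 0)) sums (1 / (1 - q) - 1 / 2)"
    using assms by (intro sums_diff geometric_sums) (auto intro: sums_single[of 0 "\<lambda>_. 1/2", simplified])
  moreover have "(\<lambda>m. fps_nth (power_fps 0) m * q ^ m) = (\<lambda>m. q ^ m - (if m = 0 then 1 / 2 else 0))"
    by (auto simp: power_fps_nth)
  ultimately show ?thesis
    by (simp add: eval_fps_def sums_iff)
qed

lemma fps_conv_radius_power_fps: "fps_conv_radius (power_fps n) \<ge> 1"
proof (induction n)
  case 0
  show ?case unfolding fps_conv_radius_def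
  proof (rule conv_radius_geI_ex')
    fix r :: real assume r: "0 < r" "ereal r < 1"
    show "summable (\<lambda>n. fps_nth (power_fps 0) n * of_real r ^ n)"
      by (rule summable_comparison_test'[of "\<lambda>n. r ^ n" 0])
         (use r in \<open>auto simp: power_fps_nth norm_mult norm_power intro!: summable_geometric\<close>)
  qed
next
  case (Suc n)
  thus ?case using fps_conv_radius_XD[of "power_fps n"]
    by (simp add: power_fps_def)
qed

text \<open>Induction by differentiation: the base case expands the cotangent in the nome; in the
  step, \<open>d/dz\<close> raises the polygamma order on the left and applies \<open>fps_XD\<close>
  on the right.\<close>

lemma Polygamma_reflection_fps:
  assumes "Im z > 0"
  shows "Polygamma n z + (-1) ^ Suc n * Polygamma n (1 - z) =
           (2 * of_real pi * \<i>) ^ Suc n * eval_fps (power_fps n) (nome z)"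
  using assms
proof (induction n arbitrary: z)
  case 0
  have "z \<notin> \<int>" using 0 by (auto elim!: Ints_cases)
  \<comment> \<open>A square root of the nome, in which sine and cosine of \<open>pi z\<close>
    become rational.\<close>
  define w where "w = exp (\<i> * (of_real pi * z))"
  have nw: "nome z = w ^ 2"
    by (simp add: nome_def w_def exp_double [symmetric] mult_ac)
  have [simp]: "w \<noteq> 0" by (simp add: w_def)
  have lt: "norm (nome z) < 1" using 0 by (rule norm_nome_less_1)
  hence ne: "1 - w ^ 2 \<noteq> 0" by (auto simp: nw)
  have e2: "exp (- (\<i> * (of_real pi * z))) = inverse w" by (simp add: w_def exp_minus)
  have c: "cos (of_real pi * z) = (w + inverse w) / 2"
    and s: "sin (of_real pi * z) = (w - inverse w) / (2 * \<i>)"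
    by (simp_all add: cos_exp_eq sin_exp_eq e2 w_def [symmetric])
  have "- of_real pi * cot (of_real pi * z) = 2 * of_real pi * \<i> * (1 / (1 - w ^ 2) - 1 / 2)"
  proof -
    have ne2: "w * w \<noteq> 1" using ne by (auto simp: power2_eq_square)
    have "cot (of_real pi * z) = \<i> * (w^2 + 1) / (w^2 - 1)"
      unfolding cot_def c s using ne2 by (simp add: field_simps power2_eq_square)
    also have "\<dots> = - (2 * \<i> * (1 / (1 - w ^ 2) - 1 / 2))"
      using ne2 ne by (simp add: divide_simps power2_eq_square) (simp add: algebra_simps)
    finally show ?thesis by simp
  qed
  with Digamma_reflection_complex[OF \<open>z \<notin> \<int>\<close>] show ?case
    using eval_power_fps_0[OF lt] by (simp add: nw)
next
  case (Suc n)
  have np: "w \<notin> \<int>\<^sub>\<le>\<^sub>0" "1 - w \<notin> \<int>\<^sub>\<le>\<^sub>0" if "Im w > 0" for w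
    using that by (auto elim!: nonpos_Ints_cases simp: complex_eq_iff)
  have "((\<lambda>w. Polygamma n w + (-1) ^ Suc n * Polygamma n (1 - w)) has_field_derivative
         Polygamma (Suc n) z + (-1) ^ Suc (Suc n) * Polygamma (Suc n) (1 - z)) (at z)"
    using np[OF Suc.prems] by (auto intro!: derivative_eq_intros)
  moreover have "((\<lambda>w. Polygamma n w + (-1) ^ Suc n * Polygamma n (1 - w)) has_field_derivative
         (2 * of_real pi * \<i>) ^ Suc (Suc n) * eval_fps (power_fps (Suc n)) (nome z)) (at z)"
  proof (rule has_field_derivative_transform_within_open[where S = "{w. Im w > 0}"])
    have "ereal (norm (nome z)) < fps_conv_radius (power_fps n)"
      using norm_nome_less_1[OF Suc.prems] fps_conv_radius_power_fps[of n]
      by (metis ereal_less(3) less_le_trans)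
    from DERIV_cmult[OF has_field_derivative_eval_fps_nome[OF this], of "(2 * of_real pi * \<i>) ^ Suc n"]
    show "((\<lambda>w. (2 * of_real pi * \<i>) ^ Suc n * eval_fps (power_fps n) (nome w)) has_field_derivative
         (2 * of_real pi * \<i>) ^ Suc (Suc n) * eval_fps (power_fps (Suc n)) (nome z)) (at z)"
      by (simp add: power_fps_def mult_ac)
  qed (use Suc in \<open>auto simp: open_halfspace_Im_gt\<close>)
  ultimately show ?case by (rule DERIV_unique)
qed

section \<open>Zeta values, the Lipschitz formula and Euler's formula for Bernoulli numbers\<close>

definition zeta_sum :: "nat \<Rightarrow> real" where
  "zeta_sum k = (\<Sum>c. 1 / real (Suc c) ^ k)"

lemma zeta_sum_sums: "k \<ge> 2 \<Longrightarrow> (\<lambda>c. 1 / real (Suc c) ^ k) sums zeta_sum k"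
  unfolding zeta_sum_def
  using inverse_power_summable[of k, where ?'a = real]
  by (subst (asm) summable_Suc_iff [symmetric]) (auto simp: inverse_eq_divide intro: summable_sums)

lemma zeta_sum_has_sum: "k \<ge> 2 \<Longrightarrow> ((\<lambda>c. 1 / real (Suc c) ^ k) has_sum zeta_sum k) UNIV"
  using zeta_sum_sums by (intro norm_summable_imp_has_sum) (auto simp: sums_iff)

lemma zeta_sum_ge_1: "k \<ge> 2 \<Longrightarrow> zeta_sum k \<ge> 1"
  using has_sum_mono2[of "\<lambda>c. 1 / real (Suc c) ^ k" "{0}" 1 UNIV "zeta_sum k"] zeta_sum_has_sum[of k]
    has_sum_finite[of "{0::nat}" "\<lambda>c. 1 / real (Suc c) ^ k"]
  by simp

lemma zeta_sum_Polygamma: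
  assumes "k \<ge> 2" "even k"
  shows "complex_of_real (zeta_sum k) = Polygamma (k - 1) 1 / fact (k - 1)"
proof -
  have "(\<lambda>j. inverse ((1 + of_nat j) ^ Suc (k - 1)))
           sums ((-1) ^ Suc (k - 1) * Polygamma (k - 1) 1 / fact (k - 1) :: complex)"
    using assms by (intro Polygamma_LIMSEQ) auto
  moreover have "(\<lambda>j. complex_of_real (1 / real (Suc j) ^ k)) sums of_real (zeta_sum k)"
    using assms(1) by (intro sums_of_real zeta_sum_sums)
  ultimately show ?thesis using assms
    by (simp add: sums_iff inverse_eq_divide add_ac)
qed

text \<open>The polygamma series at \<open>z\<close> covers the nonnegative integer shifts, the one
  at \<open>1 - z\<close> the negative ones, with the sign absorbed by the even exponent. Removing
  the shift 0 produces \<open>- 1 / z ^ k\<close>.\<close>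

lemma Lipschitz_formula:
  assumes "k \<ge> 2" "even k" "Im z > 0"
  shows "(\<lambda>d. 1 / (z + of_nat (Suc d)) ^ k + 1 / (z - of_nat (Suc d)) ^ k) sums
           ((2 * of_real pi * \<i>) ^ k / fact (k - 1) * eval_fps (power_fps (k - 1)) (nome z) - 1 / z ^ k)"
proof -
  define n where "n = k - 1"
  have k: "k = Suc n" "n > 0" "odd n" using assms by (auto simp: n_def)
  have nz: "z \<noteq> 0" "1 - z \<noteq> 0" using assms(3) by (auto simp: complex_eq_iff)
  have "(\<lambda>j. inverse ((z + of_nat j) ^ Suc n)) sums (Polygamma n z / fact n)"
    using Polygamma_LIMSEQ[OF nz(1) k(2)] k(3) by simp
  hence "(\<lambda>j. inverse ((z + of_nat (Suc j)) ^ Suc n)) sums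
           (Polygamma n z / fact n - inverse ((z + of_nat 0) ^ Suc n))"
    by (subst sums_Suc_iff) simp
  moreover have "(\<lambda>j. inverse ((1 - z + of_nat j) ^ Suc n)) sums (Polygamma n (1 - z) / fact n)"
    using Polygamma_LIMSEQ[OF nz(2) k(2)] k(3) by simp
  ultimately have *: "(\<lambda>j. inverse ((z + of_nat (Suc j)) ^ Suc n) + inverse ((1 - z + of_nat j) ^ Suc n)) sums
      (Polygamma n z / fact n - inverse ((z + of_nat 0) ^ Suc n) + Polygamma n (1 - z) / fact n)"
    by (rule sums_add)
  have flip: "(1 - z + of_nat j) ^ Suc n = (z - of_nat (Suc j)) ^ Suc n" for j
  proof -
    have "1 - z + of_nat j = - (z - of_nat (Suc j))" by simp
    moreover have "(- (z - of_nat (Suc j))) ^ Suc n = (z - of_nat (Suc j)) ^ Suc n"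
      using assms(2) k(1) by (metis power_minus_even)
    ultimately show ?thesis by (simp only:)
  qed
  have "Polygamma n z / fact n + Polygamma n (1 - z) / fact n =
      (2 * of_real pi * \<i>) ^ k / fact n * eval_fps (power_fps n) (nome z)"
    using Polygamma_reflection_fps[OF assms(3), of n] k by (simp add: add_divide_distrib [symmetric])
  hence "Polygamma n z / fact n - inverse ((z + of_nat 0) ^ Suc n) + Polygamma n (1 - z) / fact n =
      (2 * of_real pi * \<i>) ^ k / fact n * eval_fps (power_fps n) (nome z) - 1 / z ^ k"
    unfolding diff_add_eq k(1) by (simp add: inverse_eq_divide)
  with * show ?thesis
    unfolding flip inverse_eq_divide k(1) diff_Suc_1 by (simp only:)
qed

text \<open>At 0 the two terms cancel for even m and add up to
  \<open>- 2 * fact m * zeta_sum (m + 1)\<close> for odd m, so this function generates the even zeta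
  values.\<close>

lemma higher_deriv_Digamma_diff:
  assumes "norm z < 1"
  shows "(deriv ^^ m) (\<lambda>z. Digamma (1 - z) - Digamma (1 + z)) z =
           (-1) ^ m * Polygamma m (1 - z) - Polygamma m (1 + z :: complex)"
  using assms
proof (induction m arbitrary: z)
  case (Suc m)
  have np: "1 - z \<notin> \<int>\<^sub>\<le>\<^sub>0" "1 + z \<notin> \<int>\<^sub>\<le>\<^sub>0"
    using Suc.prems abs_Re_le_cmod[of z] by (auto elim!: nonpos_Ints_cases simp: complex_eq_iff)
  have "eventually (\<lambda>z. z \<in> ball 0 1) (nhds z)"
    using Suc.prems by (intro eventually_nhds_in_open) auto
  hence "eventually (\<lambda>z. (deriv ^^ m) (\<lambda>z. Digamma (1 - z) - Digamma (1 + z)) z =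
           (-1) ^ m * Polygamma m (1 - z) - Polygamma m (1 + z)) (nhds z)"
    by eventually_elim (simp add: Suc.IH)
  hence "(deriv ^^ Suc m) (\<lambda>z. Digamma (1 - z) - Digamma (1 + z)) z =
         deriv (\<lambda>z. (-1) ^ m * Polygamma m (1 - z) - Polygamma m (1 + z)) z"
    by (simp add: deriv_cong_ev)
  also have "\<dots> = (-1) ^ Suc m * Polygamma (Suc m) (1 - z) - Polygamma (Suc m) (1 + z)"
    using np by (intro DERIV_imp_deriv) (auto intro!: derivative_eq_intros)
  finally show ?case .
qed auto

text \<open>By reflection and \<open>Digamma (z + 1) = Digamma z + 1 / z\<close>, the second factor
  is \<open>pi z cot (pi z) - pi i z\<close>. The product form, free of denominators, also makes
  sense at 0.\<close>

lemma Digamma_diff_functional_equation: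
  assumes "norm z < 1"
  shows "(exp (2 * of_real pi * \<i> * z) - 1) *
           (z * (Digamma (1 - z) - Digamma (1 + z)) + 1 - of_real pi * \<i> * z) = 2 * of_real pi * \<i> * z"
proof (cases "z = 0")
  case False
  have z: "z \<notin> \<int>"
    using assms False by (auto elim!: Ints_cases)
  define w where "w = exp (\<i> * (of_real pi * z))"
  have nw: "exp (2 * of_real pi * \<i> * z) = w ^ 2"
    by (simp add: w_def exp_double [symmetric] mult_ac)
  have [simp]: "w \<noteq> 0" by (simp add: w_def)
  have e2: "exp (- (\<i> * (of_real pi * z))) = inverse w" by (simp add: w_def exp_minus)
  have c: "cos (of_real pi * z) = (w + inverse w) / 2"
    and s: "sin (of_real pi * z) = (w - inverse w) / (2 * \<i>)"
    by (simp_all add: cos_exp_eq sin_exp_eq e2 w_def [symmetric])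
  have "sin (of_real pi * z) \<noteq> 0"
    using z by (auto simp: sin_eq_0 mult.commute)
  hence ne2: "w * w \<noteq> 1" unfolding s by (auto simp: field_simps)
  have cot: "cot (of_real pi * z) = \<i> * (w^2 + 1) / (w^2 - 1)"
    unfolding cot_def c s using ne2 by (simp add: field_simps power2_eq_square)
  have "Digamma (1 - z) - Digamma (1 + z) = of_real pi * cot (of_real pi * z) - 1 / z"
    using Digamma_reflection_complex[OF z] Polygamma_plus1[OF False, of 0]
    by (simp add: algebra_simps)
  hence "z * (Digamma (1 - z) - Digamma (1 + z)) + 1 = of_real pi * z * cot (of_real pi * z)"
    using False by (simp add: field_simps)
  thus ?thesis
    unfolding nw cot using ne2 by (simp add: field_simps power2_eq_square)
qed auto

text \<open>Euler's formula. With \<open>c = 2 pi i\<close>, the rescaled Bernoulli series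
  \<open>b'\<close> and the series built from the zeta values both give \<open>c X\<close> when
  multiplied by \<open>fps_exp c - 1\<close>. Formal power series have no zero divisors, so the two
  agree.\<close>

lemma bernoulli_zeta:
  assumes "k \<ge> 2" "even k"
  shows "complex_of_real (bernoulli k) * (2 * of_real pi * \<i>) ^ k = - 2 * fact k * of_real (zeta_sum k)"
proof -
  define D where "D = (\<lambda>z::complex. Digamma (1 - z) - Digamma (1 + z))"
  define F where "F = fps_expansion D 0"
  define c where "c = 2 * of_real pi * \<i>"
  define b :: "real fps" where "b = fps_X / (fps_exp 1 - 1)"
  define b' where "b' = Abs_fps (\<lambda>n. of_real (fps_nth b n) * c ^ n)"
  have [simp]: "c \<noteq> 0" by (simp add: c_def)
  have "1 - z \<notin> \<int>\<^sub>\<le>\<^sub>0" "1 + z \<notin> \<int>\<^sub>\<le>\<^sub>0" if "norm z < 1" for z :: complex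
    using that abs_Re_le_cmod[of z] by (auto elim!: nonpos_Ints_cases simp: complex_eq_iff)
  hence "D analytic_on ball 0 1"
    unfolding D_def by (auto intro!: analytic_intros)
  hence DF: "D has_fps_expansion F"
    unfolding F_def
    by (intro has_fps_expansion_fps_expansion[of "ball 0 1"]) (auto dest: analytic_imp_holomorphic)
  have "(\<lambda>z. (exp (c * z) - 1) * (z * D z + 1 - of_real pi * \<i> * z)) has_fps_expansion
          ((fps_exp c - 1) * (fps_X * F + 1 - fps_const (of_real pi * \<i>) * fps_X))"
    by (intro fps_expansion_intros DF)
  moreover have "(\<lambda>z. (exp (c * z) - 1) * (z * D z + 1 - of_real pi * \<i> * z)) has_fps_expansion
          (fps_const c * fps_X)"
  proof -
    have "(\<lambda>z. c * z) has_fps_expansion (fps_const c * fps_X)"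
      by (intro fps_expansion_intros)
    moreover have "eventually (\<lambda>z. z \<in> ball 0 1) (nhds (0::complex))"
      by (intro eventually_nhds_in_open) auto
    hence "eventually (\<lambda>z. c * z = (exp (c * z) - 1) * (z * D z + 1 - of_real pi * \<i> * z)) (nhds 0)"
      by eventually_elim (use Digamma_diff_functional_equation in \<open>simp add: c_def D_def\<close>)
    ultimately show ?thesis
      unfolding has_fps_expansion_def by (auto elim: eventually_elim2)
  qed
  ultimately have 1: "(fps_exp c - 1) * (fps_X * F + 1 - fps_const (of_real pi * \<i>) * fps_X) =
                       fps_const c * fps_X"
    by (rule fps_expansion_unique_complex)
  have "(fps_exp 1 - 1 :: real fps) \<noteq> 0"
    by (auto simp: fps_eq_iff intro!: exI[of _ 1])
  moreover have "subdegree (fps_exp 1 - 1 :: real fps) = 1"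
    by (rule subdegreeI) auto
  ultimately have 2: "(fps_exp 1 - 1) * b = fps_X"
    unfolding b_def by (intro dvd_mult_div_cancel) (subst fps_dvd_iff, auto)
  have 3: "(fps_exp c - 1) * b' = fps_const c * fps_X"
  proof (rule fps_ext)
    fix n
    have *: "fps_nth (fps_exp c - 1) i = of_real (fps_nth (fps_exp 1 - 1) i) * c ^ i" for i
      by (cases "i = 0") (auto simp: field_simps)
    have "fps_nth ((fps_exp c - 1) * b') n =
            (\<Sum>i=0..n. of_real (fps_nth (fps_exp 1 - 1) i * fps_nth b (n - i)) * (c ^ i * c ^ (n - i)))"
      unfolding fps_mult_nth * by (simp add: b'_def mult_ac)
    also have "\<dots> = (\<Sum>i=0..n. of_real (fps_nth (fps_exp 1 - 1) i * fps_nth b (n - i)) * c ^ n)"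
      by (intro sum.cong refl) (auto simp flip: power_add)
    also have "\<dots> = of_real (fps_nth ((fps_exp 1 - 1) * b) n) * c ^ n"
      unfolding fps_mult_nth by (simp add: sum_distrib_right)
    also have "\<dots> = fps_nth (fps_const c * fps_X) n"
      unfolding 2 by (cases "n = 1") auto
    finally show "fps_nth ((fps_exp c - 1) * b') n = fps_nth (fps_const c * fps_X) n" .
  qed
  have "(fps_exp c - 1) \<noteq> 0"
    using 3 by (auto simp: fps_eq_iff dest: spec[of _ 1])
  with 1 3 have "b' = fps_X * F + 1 - fps_const (of_real pi * \<i>) * fps_X"
    by (metis mult_left_cancel)
  hence "fps_nth b' k = fps_nth F (k - 1)"
    using assms(1) by simp
  also have "\<dots> = ((-1) ^ (k - 1) * Polygamma (k - 1) 1 - Polygamma (k - 1) 1) / fact (k - 1)"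
    using higher_deriv_Digamma_diff[of 0 "k - 1"]
    by (simp add: fps_nth_fps_expansion[OF DF] D_def)
  also have "\<dots> = - 2 * of_real (zeta_sum k)"
    using assms by (simp add: zeta_sum_Polygamma)
  finally have "of_real (fps_nth b k) * c ^ k = - 2 * complex_of_real (zeta_sum k)"
    by (simp add: b'_def)
  thus ?thesis
    by (simp add: bernoulli_def b_def c_def mult_ac)
qed

section \<open>Lambert series and divisor sums\<close>

lemma has_sum_power_fps:
  assumes "l \<ge> 1" "norm q < 1"
  shows "((\<lambda>m. of_nat m ^ l * q ^ m) has_sum eval_fps (power_fps l) q) {1..}"
proof -
  have q: "ereal (norm q) < fps_conv_radius (power_fps l)"
    using assms(2) fps_conv_radius_power_fps[of l] by (metis ereal_less(3) less_le_trans)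
  have "((\<lambda>m. fps_nth (power_fps l) m * q ^ m) has_sum eval_fps (power_fps l) q) UNIV"
    by (intro norm_summable_imp_has_sum norm_summable_fps sums_eval_fps q)
  thus ?thesis
    by (rule has_sum_cong_neutral[THEN iffD1, rotated -1])
       (use assms in \<open>auto simp: power_fps_nth\<close>)
qed

lemma has_sum_nonneg_product:
  fixes f g :: "nat \<Rightarrow> real"
  assumes "(f has_sum a) A" "(g has_sum b) B" "\<And>x. x \<in> A \<Longrightarrow> f x \<ge> 0" "\<And>x. x \<in> B \<Longrightarrow> g x \<ge> 0"
  shows "((\<lambda>(x, y). f x * g y) has_sum (a * b)) (A \<times> B)"
proof -
  have 1: "((\<lambda>y. case (x, y) of (x, y) \<Rightarrow> f x * g y) has_sum (f x * b)) B" for x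
    using has_sum_cmult_right[OF assms(2)] by simp
  have 2: "((\<lambda>x. f x * b) has_sum (a * b)) A"
    using has_sum_cmult_left[OF assms(1)] by simp
  have "(\<lambda>(x, y). f x * g y) summable_on (A \<times> B)"
    by (rule summable_on_SigmaI[OF 1]) (use assms 2 in \<open>auto simp: summable_on_def\<close>)
  thus ?thesis
    by (intro has_sum_SigmaI[OF 1 2]) auto
qed

text \<open>One absolutely summable double series over (c, m) is summed in two ways: by rows, and by
  the value of the product \<open>n = c * m\<close>, with m as the divisor of n.\<close>

lemma Lambert_series_divisor_sigma:
  assumes "l \<ge> 1" "norm q < 1"
  obtains S where "((\<lambda>c. eval_fps (power_fps l) (q ^ c)) has_sum S) {1..}"
                  "((\<lambda>n. of_nat (divisor_sigma l n) * q ^ n) has_sum S) {1..}"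
proof -
  define f where "f = (\<lambda>(c::nat, m::nat). of_nat m ^ l * q ^ (c * m) :: complex)"
  have "f summable_on {1..} \<times> {1..}"
  proof (cases "q = 0")
    case True
    have "(f has_sum 0) ({1..} \<times> {1..})"
      by (rule has_sum_cong[THEN iffD2, OF _ has_sum_0]) (auto simp: f_def True)
    thus ?thesis by (auto simp: summable_on_def)
  next
    case False
    define r where "r = norm q"
    have r: "r > 0" "r < 1" using False assms by (auto simp: r_def)
    have 1: "((\<lambda>m. real m ^ l * r ^ m) has_sum infsum (\<lambda>m. real m ^ l * r ^ m) {1..}) {1..}"
    proof -
      have "(\<lambda>m. norm (of_nat m ^ l * q ^ m)) summable_on {1..}"
        by (rule summable_on_iff_abs_summable_on_complex[THEN iffD1])
           (rule has_sum_imp_summable[OF has_sum_power_fps[OF assms]])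
      thus ?thesis by (intro has_sum_infsum) (simp add: norm_mult norm_power r_def)
    qed
    have "((\<lambda>c. r ^ c) has_sum (1 / (1 - r))) UNIV"
      using r by (intro norm_summable_imp_has_sum geometric_sums) auto
    hence "(\<lambda>c. r ^ c) summable_on {1..}"
      by (rule summable_on_subset_banach[OF has_sum_imp_summable]) auto
    hence 2: "((\<lambda>c. r ^ c) has_sum infsum (\<lambda>c. r ^ c) {1..}) {1..}"
      by (rule has_sum_infsum)
    have "(\<lambda>(c, m). r ^ c * (real m ^ l * r ^ m)) summable_on ({1..} \<times> {1..})"
      by (rule has_sum_imp_summable[OF has_sum_nonneg_product[OF 2 1]]) (use r in auto)
    hence "(\<lambda>x. inverse r * (case x of (c, m) \<Rightarrow> r ^ c * (real m ^ l * r ^ m))) summable_on ({1..} \<times> {1..})"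
      by (rule summable_on_cmult_right)
    hence "(\<lambda>x. norm (f x)) summable_on ({1..} \<times> {1..})"
    proof (rule summable_on_comparison_test)
      fix x :: "nat \<times> nat" assume "x \<in> {1..} \<times> {1..}"
      then obtain c m where x: "x = (Suc c, Suc m)"
        by (metis SigmaE atLeast_iff One_nat_def Suc_le_D)
      \<comment> \<open>Replacing the product in the exponent by a sum decouples c from m; the
        exponent is one short of \<open>Suc c + Suc m\<close>, hence the factor
        \<open>inverse r\<close>.\<close>
      have "r ^ (Suc c * Suc m) \<le> r ^ (c + Suc m)"
        using r by (intro power_decreasing) auto
      also have "\<dots> = inverse r * (r ^ Suc c * r ^ Suc m)"
        using r by (simp add: power_add)
      finally have "real (Suc m) ^ l * r ^ (Suc c * Suc m) \<le>
                    real (Suc m) ^ l * (inverse r * (r ^ Suc c * r ^ Suc m))"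
        by (intro mult_left_mono) auto
      moreover have "norm (f x) = real (Suc m) ^ l * r ^ (Suc c * Suc m)"
        unfolding f_def x r_def by (simp only: prod.case norm_mult norm_power norm_of_nat)
      ultimately show "norm (f x) \<le> inverse r * (case x of (c, m) \<Rightarrow> r ^ c * (real m ^ l * r ^ m))"
        unfolding x by (simp only: prod.case mult_ac)
    qed auto
    thus ?thesis by (rule abs_summable_summable)
  qed
  then obtain S where S: "(f has_sum S) ({1..} \<times> {1..})"
    by (auto simp: summable_on_def)
  have 1: "((\<lambda>c. eval_fps (power_fps l) (q ^ c)) has_sum S) {1..}"
  proof (rule has_sum_SigmaD[OF S])
    fix c :: nat assume "c \<in> {1..}"
    hence "norm (q ^ c) < 1" using assms(2) by (simp add: norm_power power_less_one_iff)
    from has_sum_power_fps[OF assms(1) this]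
    show "((\<lambda>m. f (c, m)) has_sum eval_fps (power_fps l) (q ^ c)) {1..}"
      by (simp add: f_def power_mult)
  qed
  define g where "g = (\<lambda>(n::nat, d::nat). of_nat d ^ l * q ^ n :: complex)"
  have S': "(g has_sum S) (Sigma {1..} (\<lambda>n. {d. d dvd n}))"
  proof -
    have "(f has_sum S) ({1..} \<times> {1..}) \<longleftrightarrow> (g has_sum S) (Sigma {1..} (\<lambda>n. {d. d dvd n}))"
      by (rule has_sum_reindex_bij_witness[of _ "\<lambda>(n, d). (n div d, d)" "\<lambda>(c, m). (c * m, m)"])
         (auto simp: f_def g_def Suc_le_eq elim!: dvdE)
    with S show ?thesis by simp
  qed
  have "((\<lambda>n. of_nat (divisor_sigma l n) * q ^ n) has_sum S) {1..}"
  proof (rule has_sum_SigmaD[OF S'])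
    fix n :: nat assume "n \<in> {1..}"
    hence "finite {d. d dvd n}" by auto
    from has_sum_finite[OF this, of "\<lambda>d. g (n, d)"]
    show "((\<lambda>d. g (n, d)) has_sum of_nat (divisor_sigma l n) * q ^ n) {d. d dvd n}"
      by (simp add: g_def divisor_sigma_def sum_distrib_right)
  qed
  with 1 show ?thesis using that by blast
qed

lemma has_sum_atLeast_1_iff: "(f has_sum S) {1::nat..} \<longleftrightarrow> ((\<lambda>n. f (Suc n)) has_sum S) UNIV"
  by (rule has_sum_reindex_bij_witness[of _ Suc "\<lambda>n. n - 1"]) auto

section \<open>Lattice sums and their size\<close>

text \<open>Only pairs off the axes are summed, one from each pair \<open>\<plusminus>(c, d)\<close>: the axes contribute
  \<open>\<zeta>(k) (1 + 1/z^k)\<close>, so after division by \<open>\<zeta>(k)\<close> no restriction to coprime pairs is needed.\<close>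
definition lattice_term :: "nat \<Rightarrow> complex \<Rightarrow> nat \<times> nat \<Rightarrow> complex" where
  "lattice_term k z = (\<lambda>(c, d). 1 / (of_nat (Suc c) * z + of_nat (Suc d)) ^ k +
                                1 / (of_nat (Suc c) * z - of_nat (Suc d)) ^ k)"

definition lattice_sum :: "nat \<Rightarrow> complex \<Rightarrow> complex" where
  "lattice_sum k z = infsum (lattice_term k z) UNIV"

text \<open>Expanding the squared norm reduces both bounds to
  \<open>(c * norm z - d)^2 \<ge> 0\<close>. The right-hand sides factor in c and d, which turns a
  majorant over pairs into a product of zeta sums.\<close>

lemma cmod_power2_linear_ge:
  fixes c d :: real
  shows "norm (of_real c * z + of_real d) ^ 2 \<ge> 2 * c * d * (norm z + Re z)"
    and "norm (of_real c * z - of_real d) ^ 2 \<ge> 2 * c * d * (norm z - Re z)"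
proof -
  have *: "norm (of_real c * z + of_real d) ^ 2 = c\<^sup>2 * norm z ^ 2 + 2 * c * d * Re z + d\<^sup>2" for d
    unfolding cmod_power2 by (simp add: power2_eq_square algebra_simps)
  show "norm (of_real c * z + of_real d) ^ 2 \<ge> 2 * c * d * (norm z + Re z)"
    using sum_squares_ge_zero[of "c * norm z - d" 0]
    unfolding * by (simp add: power2_eq_square algebra_simps)
  show "norm (of_real c * z - of_real d) ^ 2 \<ge> 2 * c * d * (norm z - Re z)"
    using sum_squares_ge_zero[of "c * norm z - d" 0] *[of "-d"]
    by (simp add: power2_eq_square algebra_simps)
qed

lemma norm_lattice_term_le:
  assumes "Im z > 0"
  shows "norm (lattice_term (2 * m) z (c, d)) \<le>
           (1 / (2 * (norm z + Re z)) ^ m + 1 / (2 * (norm z - Re z)) ^ m) *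
           (1 / real (Suc c) ^ m * (1 / real (Suc d) ^ m))"
proof -
  define C D where "C = real (Suc c)" "D = real (Suc d)"
  have CD: "C > 0" "D > 0" by (auto simp: C_D_def)
  have "\<bar>Re z\<bar> < norm z"
    using assms by (intro power2_less_imp_less[of "\<bar>Re z\<bar>"]) (auto simp: cmod_power2)
  hence pos: "norm z + Re z > 0" "norm z - Re z > 0" by auto
  have *: "norm (1 / w ^ (2 * m)) \<le> 1 / (2 * y) ^ m * (1 / C ^ m * (1 / D ^ m))"
    if "norm w ^ 2 \<ge> 2 * C * D * y" "y > 0" for w :: complex and y
  proof -
    define X where "X = 2 * C * D * y"
    have X: "X > 0" "norm w ^ 2 \<ge> X"
      using that CD unfolding X_def by (auto intro!: mult_pos_pos)
    hence "1 / (norm w ^ 2) ^ m \<le> 1 / X ^ m"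
      by (intro frac_le power_mono zero_less_power) auto
    also have "\<dots> = 1 / (2 * y) ^ m * (1 / C ^ m * (1 / D ^ m))"
      by (simp add: X_def power_mult_distrib field_simps)
    finally show ?thesis by (simp add: norm_divide norm_power power_mult)
  qed
  have "norm (lattice_term (2 * m) z (c, d)) \<le>
          norm (1 / (of_real C * z + of_real D) ^ (2 * m)) + norm (1 / (of_real C * z - of_real D) ^ (2 * m))"
    unfolding lattice_term_def C_D_def by (simp only: prod.case of_real_of_nat_eq norm_triangle_ineq)
  also have "\<dots> \<le> 1 / (2 * (norm z + Re z)) ^ m * (1 / C ^ m * (1 / D ^ m)) +
                  1 / (2 * (norm z - Re z)) ^ m * (1 / C ^ m * (1 / D ^ m))"
    using pos by (intro add_mono * cmod_power2_linear_ge)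
  finally show ?thesis
    unfolding C_D_def by (simp only: distrib_right)
qed

lemma lattice_sum_bound:
  assumes "Im z > 0" "m \<ge> 2"
  shows "lattice_term (2 * m) z summable_on UNIV"
    and "norm (lattice_sum (2 * m) z) \<le>
           (1 / (2 * (norm z + Re z)) ^ m + 1 / (2 * (norm z - Re z)) ^ m) * zeta_sum m ^ 2"
proof -
  define B where "B = 1 / (2 * (norm z + Re z)) ^ m + 1 / (2 * (norm z - Re z)) ^ m"
  have "((\<lambda>(c, d). 1 / real (Suc c) ^ m * (1 / real (Suc d) ^ m)) has_sum (zeta_sum m * zeta_sum m)) (UNIV \<times> UNIV)"
    using assms(2) by (intro has_sum_nonneg_product zeta_sum_has_sum) auto
  from has_sum_cmult_right[OF this, of B]
  have bd: "((\<lambda>x. B * (case x of (c, d) \<Rightarrow> 1 / real (Suc c) ^ m * (1 / real (Suc d) ^ m)))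
               has_sum (B * zeta_sum m ^ 2)) UNIV"
    by (simp add: power2_eq_square)
  have le: "norm (lattice_term (2 * m) z x) \<le> B * (case x of (c, d) \<Rightarrow> 1 / real (Suc c) ^ m * (1 / real (Suc d) ^ m))" for x
    using norm_lattice_term_le[OF assms(1), of m "fst x" "snd x"]
    unfolding B_def by (cases x) (simp only: prod.case fst_conv snd_conv)
  have "(\<lambda>x. norm (lattice_term (2 * m) z x)) summable_on UNIV"
    by (rule summable_on_comparison_test[OF has_sum_imp_summable[OF bd]]) (use le in auto)
  thus *: "lattice_term (2 * m) z summable_on UNIV"
    by (rule abs_summable_summable)
  show "norm (lattice_sum (2 * m) z) \<le> B * zeta_sum m ^ 2"
    unfolding lattice_sum_def by (rule norm_infsum_le[OF has_sum_infsum[OF *] bd le])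
qed

text \<open>Up to the factor \<open>z ^ k\<close>, inversion only exchanges c and d; the sign it
  introduces disappears because k is even.\<close>

lemma lattice_sum_inversion:
  assumes "even k" "z \<noteq> 0"
  shows "lattice_sum k (-1 / z) = z ^ k * lattice_sum k z"
proof -
  have "lattice_sum k (-1 / z) = infsum (\<lambda>x. lattice_term k (-1 / z) (prod.swap x)) UNIV"
    unfolding lattice_sum_def by (rule infsum_reindex_bij_betw [symmetric]) (rule bij_swap)
  also have "(\<lambda>x. lattice_term k (-1 / z) (prod.swap x)) = (\<lambda>x. z ^ k * lattice_term k z x)"
  proof
    fix x :: "nat \<times> nat"
    obtain c d where x: "x = (c, d)" by (cases x)
    define C D where "C = (of_nat (Suc c) :: complex)" "D = (of_nat (Suc d) :: complex)"
    have "D * (-1 / z) + C = (C * z - D) / z" "D * (-1 / z) - C = - ((C * z + D) / z)"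
      using assms(2) by (auto simp: field_simps)
    moreover have "(- ((C * z + D) / z)) ^ k = ((C * z + D) / z) ^ k"
      using assms(1) by (rule power_minus_even)
    ultimately have "1 / (D * (-1 / z) + C) ^ k + 1 / (D * (-1 / z) - C) ^ k =
                     z ^ k * (1 / (C * z + D) ^ k + 1 / (C * z - D) ^ k)"
      by (simp add: power_divide distrib_left)
    thus "lattice_term k (-1 / z) (prod.swap x) = z ^ k * lattice_term k z x"
      unfolding lattice_term_def x C_D_def by (simp only: prod.swap_def prod.case fst_conv snd_conv)
  qed
  also have "infsum \<dots> UNIV = z ^ k * lattice_sum k z"
    unfolding lattice_sum_def by (rule infsum_cmult_right')
  finally show ?thesis .
qed

section \<open>Lattice expansion and symmetries of the Eisenstein series\<close>

lemma nome_of_nat_mult: "nome (of_nat c * z) = nome z ^ c"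
  by (simp add: nome_def exp_of_nat_mult [symmetric] mult_ac)

lemma eisenstein_series_sums:
  assumes "k \<ge> 2" "norm q < 1" "((\<lambda>n. of_nat (divisor_sigma (k - 1) n) * q ^ n) has_sum S) {1..}"
  shows "(\<lambda>n. fps_nth (eisenstein_fps k) n * q ^ n) sums (1 - of_real (2 * real k / bernoulli k) * S)"
proof -
  define c :: complex where "c = of_real (2 * real k / bernoulli k)"
  have "(\<lambda>n. of_nat (divisor_sigma (k - 1) (Suc n)) * q ^ Suc n) sums S"
    using assms(3) by (intro has_sum_imp_sums) (simp only: has_sum_atLeast_1_iff)
  hence "(\<lambda>n. - c * (of_nat (divisor_sigma (k - 1) (Suc n)) * q ^ Suc n)) sums (- c * S)"
    by (rule sums_mult)
  hence "(\<lambda>n. fps_nth (eisenstein_fps k) (Suc n) * q ^ Suc n) sums (- c * S)"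
    by (simp add: eisenstein_fps_def c_def mult_ac)
  thus ?thesis
    by (subst (asm) sums_Suc_iff) (simp add: eisenstein_fps_def c_def)
qed

lemma fps_conv_radius_eisenstein:
  assumes "k \<ge> 2"
  shows "fps_conv_radius (eisenstein_fps k) \<ge> 1"
  unfolding fps_conv_radius_def
proof (rule conv_radius_geI_ex')
  fix r :: real assume r: "0 < r" "ereal r < 1"
  hence q: "norm (of_real r :: complex) < 1" by auto
  obtain S where "((\<lambda>n. of_nat (divisor_sigma (k - 1) n) * complex_of_real r ^ n) has_sum S) {1..}"
    by (rule Lambert_series_divisor_sigma[OF _ q, of "k - 1"]) (use assms in auto)
  from eisenstein_series_sums[OF assms q this]
  show "summable (\<lambda>n. fps_nth (eisenstein_fps k) n * complex_of_real r ^ n)"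
    by (auto simp: sums_iff)
qed

text \<open>The Lipschitz formula at \<open>c z\<close> is summed over c. The removed shifts 0
  contribute \<open>zeta_sum k / z ^ k\<close>, the rest is \<open>A\<close> times the Lambert
  series, and Euler's formula identifies \<open>A / zeta_sum k\<close> with
  \<open>- 2 k / bernoulli k\<close>.\<close>

lemma eisenstein_E_lattice_sum:
  assumes "k \<ge> 4" "even k" "Im z > 0"
  shows "eisenstein_E k z = 1 + 1 / z ^ k + lattice_sum k z / of_real (zeta_sum k)"
proof -
  have k2: "k \<ge> 2" "k - 1 \<ge> 1" using assms(1) by auto
  have q: "norm (nome z) < 1" using assms(3) by (rule norm_nome_less_1)
  define A where "A = (2 * of_real pi * \<i>) ^ k / (fact (k - 1) :: complex)"
  obtain S where S1: "((\<lambda>c. eval_fps (power_fps (k - 1)) (nome z ^ c)) has_sum S) {1..}"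
    and S2: "((\<lambda>n. of_nat (divisor_sigma (k - 1) n) * nome z ^ n) has_sum S) {1..}"
    using Lambert_series_divisor_sigma[OF k2(2) q] by blast
  have E: "eisenstein_E k z = 1 - of_real (2 * real k / bernoulli k) * S"
    using eisenstein_series_sums[OF k2(1) q S2]
    by (simp add: eisenstein_E_def eval_fps_def sums_iff)
  have summ: "lattice_term k z summable_on (UNIV \<times> UNIV)"
    using lattice_sum_bound(1)[OF assms(3), of "k div 2"] assms by simp
  have "((\<lambda>c. A * eval_fps (power_fps (k - 1)) (nome z ^ Suc c) - 1 / (of_nat (Suc c) * z) ^ k)
           has_sum lattice_sum k z) UNIV"
  proof (rule has_sum_SigmaD[where B = "\<lambda>_. UNIV"])
    show "(lattice_term k z has_sum lattice_sum k z) (UNIV \<times> UNIV)"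
      unfolding lattice_sum_def using has_sum_infsum[OF summ] by simp
    fix c :: nat
    have "(\<lambda>(c, d). lattice_term k z (c, d)) summable_on (UNIV \<times> UNIV)"
      using summ by simp
    hence "(\<lambda>d. lattice_term k z (c, d)) summable_on UNIV"
      by (rule summable_on_SigmaD1) auto
    hence hs: "((\<lambda>d. lattice_term k z (c, d)) has_sum infsum (\<lambda>d. lattice_term k z (c, d)) UNIV) UNIV"
      by (rule has_sum_infsum)
    have "Im (of_nat (Suc c) * z) > 0"
      using assms(3) by simp
    from Lipschitz_formula[OF k2(1) assms(2) this]
    have "(\<lambda>d. lattice_term k z (c, d)) sums
            (A * eval_fps (power_fps (k - 1)) (nome z ^ Suc c) - 1 / (of_nat (Suc c) * z) ^ k)"
      unfolding lattice_term_def prod.case A_def nome_of_nat_mult .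
    \<comment> \<open>The Lipschitz formula is an ordered sum; unordered summability of each row
      comes from the double series, so the two values coincide.\<close>
    with has_sum_imp_sums[OF hs] hs
    show "((\<lambda>d. lattice_term k z (c, d)) has_sum
            (A * eval_fps (power_fps (k - 1)) (nome z ^ Suc c) - 1 / (of_nat (Suc c) * z) ^ k)) UNIV"
      using sums_unique2 by metis
  qed
  moreover have "((\<lambda>c. 1 / (of_nat (Suc c) * z) ^ k) has_sum (of_real (zeta_sum k) * (1 / z ^ k))) UNIV"
  proof -
    have "((\<lambda>c. complex_of_real (1 / real (Suc c) ^ k) * (1 / z ^ k)) has_sum
             (of_real (zeta_sum k) * (1 / z ^ k))) UNIV"
      by (intro has_sum_cmult_left has_sum_of_real zeta_sum_has_sum k2)
    thus ?thesis by (simp add: power_mult_distrib)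
  qed
  ultimately have "((\<lambda>c. A * eval_fps (power_fps (k - 1)) (nome z ^ Suc c) - 1 / (of_nat (Suc c) * z) ^ k
             + 1 / (of_nat (Suc c) * z) ^ k) has_sum (lattice_sum k z + of_real (zeta_sum k) * (1 / z ^ k))) UNIV"
    by (rule has_sum_add)
  hence "((\<lambda>c. A * eval_fps (power_fps (k - 1)) (nome z ^ Suc c)) has_sum
            (lattice_sum k z + of_real (zeta_sum k) * (1 / z ^ k))) UNIV"
    by (simp only: diff_add_cancel)
  moreover have "((\<lambda>c. A * eval_fps (power_fps (k - 1)) (nome z ^ Suc c)) has_sum (A * S)) UNIV"
    using S1 by (intro has_sum_cmult_right) (simp only: has_sum_atLeast_1_iff)
  ultimately have AS: "A * S = lattice_sum k z + of_real (zeta_sum k) * (1 / z ^ k)"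
    by (metis has_sum_unique)
  have zp: "zeta_sum k > 0" using zeta_sum_ge_1[OF k2(1)] by simp
  have b: "complex_of_real (bernoulli k) * (2 * of_real pi * \<i>) ^ k = - 2 * fact k * of_real (zeta_sum k)"
    by (rule bernoulli_zeta) (use assms k2 in auto)
  have b0: "bernoulli k \<noteq> 0"
    using b zp by auto
  have "fact k = (of_nat k * fact (k - 1) :: complex)"
    using assms(1) by (intro fact_reduce) auto
  hence "A = - of_real (2 * real k / bernoulli k) * of_real (zeta_sum k)"
    using b b0 unfolding A_def by (simp add: field_simps)
  hence "- of_real (2 * real k / bernoulli k) * S * of_real (zeta_sum k) = 
          lattice_sum k z + of_real (zeta_sum k) * (1 / z ^ k)"
    using AS by (simp add: mult_ac)
  hence "- of_real (2 * real k / bernoulli k) * S = (lattice_sum k z + of_real (zeta_sum k) * (1 / z ^ k)) / of_real (zeta_sum k)"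
    using zp by (simp add: field_simps)
  also have "\<dots> = 1 / z ^ k + lattice_sum k z / of_real (zeta_sum k)"
    using zp by (simp add: field_simps)
  finally show ?thesis unfolding E by simp
qed

lemma eisenstein_E_inversion:
  assumes "k \<ge> 4" "even k" "Im z > 0"
  shows "eisenstein_E k (-1 / z) = z ^ k * eisenstein_E k z"
proof -
  have [simp]: "z \<noteq> 0" using assms(3) by auto
  have "Im (-1 / z) > 0"
    using assms(3) by (auto simp: Im_divide intro!: divide_pos_pos add_nonneg_pos)
  moreover have "(-1 / z) ^ k = 1 / z ^ k"
    using assms(2) by (simp add: power_divide)
  ultimately have "eisenstein_E k (-1 / z) = 1 + z ^ k + lattice_sum k (-1 / z) / of_real (zeta_sum k)"
    by (simp only: eisenstein_E_lattice_sum[OF assms(1,2)]) simp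
  thus ?thesis
    using assms by (simp add: eisenstein_E_lattice_sum lattice_sum_inversion algebra_simps
                         del: minus_divide_left divide_minus_left)
qed

lemma eval_fps_cnj:
  assumes "\<And>n. fps_nth F n \<in> \<real>" "ereal (norm q) < fps_conv_radius F"
  shows "eval_fps F (cnj q) = cnj (eval_fps F q)"
proof -
  have "(\<lambda>n. cnj (fps_nth F n * q ^ n)) sums cnj (eval_fps F q)"
    using sums_eval_fps[OF assms(2)] by (simp only: sums_cnj)
  thus ?thesis
    using assms(1) by (simp add: eval_fps_def sums_iff Reals_cnj_iff)
qed

lemma eisenstein_fps_nth_Reals: "fps_nth (eisenstein_fps k) n \<in> \<real>"
  by (auto simp: eisenstein_fps_def)

lemma nome_minus_cnj: "nome (- cnj z) = cnj (nome z)"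
  by (simp add: nome_def exp_cnj)

lemma eisenstein_E_minus_cnj:
  assumes "k \<ge> 2" "Im z > 0"
  shows "eisenstein_E k (- cnj z) = cnj (eisenstein_E k z)"
proof -
  have "ereal (norm (nome z)) < fps_conv_radius (eisenstein_fps k)"
    using norm_nome_less_1[OF assms(2)] fps_conv_radius_eisenstein[OF assms(1)]
    by (metis ereal_less(3) less_le_trans)
  thus ?thesis
    unfolding eisenstein_E_def nome_minus_cnj by (intro eval_fps_cnj eisenstein_fps_nth_Reals)
qed

section \<open>Zeros of Eisenstein series near the top of the arc\<close>

lemma cos_ge_quadratic: "cos x \<ge> 1 - x ^ 2 / 2" for x :: real
proof -
  obtain t where "cos x = (\<Sum>m<2. cos_coeff m * x ^ m) + (cos (t + 1/2 * real 2 * pi) / fact 2) * x ^ 2"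
    using Maclaurin_cos_expansion[of x 2] by blast
  moreover have "{..<2::nat} = {0, 1}" by auto
  ultimately have "cos x = 1 - cos t * x ^ 2 / 2"
    by (simp add: cos_coeff_def)
  moreover have "cos t * x ^ 2 \<le> 1 * x ^ 2"
    by (intro mult_right_mono) auto
  ultimately show ?thesis by simp
qed

lemma cos_le_quartic: "cos x \<le> 1 - x ^ 2 / 2 + x ^ 4 / 24" for x :: real
proof -
  obtain t where "cos x = (\<Sum>m<4. cos_coeff m * x ^ m) + (cos (t + 1/2 * real 4 * pi) / fact 4) * x ^ 4"
    using Maclaurin_cos_expansion[of x 4] by blast
  moreover have "{..<4::nat} = {0, 1, 2, 3}" by auto
  ultimately have "cos x = 1 - x ^ 2 / 2 + cos (t + 2 * pi) * x ^ 4 / 24"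
    by (simp add: cos_coeff_def fact_numeral)
  moreover have "cos (t + 2 * pi) * x ^ 4 \<le> 1 * x ^ 4"
    by (intro mult_right_mono) auto
  ultimately show ?thesis by simp
qed

text \<open>The value 0.41 is half the error bound 0.82 for \<open>rsd_function\<close>, and 0.43 is
  the half-width of the strip about \<open>pi / 2\<close> that must contain its zeros.\<close>

lemma sin_43_100_gt: "sin (43 / 100) > (41 / 100 :: real)"
proof -
  have "{..<5::nat} = {0, 1, 2, 3, 4}" by auto
  \<comment> \<open>The fraction is \<open>x - x^3 / 6\<close> at \<open>x = 0.43\<close>.\<close>
  hence "\<bar>sin (43 / 100) - 2500493 / 6000000\<bar> \<le> (1 / 1000 :: real)"
    using Maclaurin_sin_bound[of "43 / 100" 5]
    by (simp add: sin_coeff_def fact_numeral power_divide)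
  thus ?thesis unfolding abs_le_iff by linarith
qed

text \<open>For \<open>x \<ge> 1\<close> one has \<open>(x + 1)^4 \<ge> 16\<close>, so each term
  after the first is at most \<open>1 / (16 x (x + 1))\<close>, and these telescope to
  \<open>1 / 16\<close>.\<close>

lemma zeta_sum_le:
  assumes "m \<ge> 6"
  shows "zeta_sum m \<le> 17 / 16"
proof -
  define g :: "nat \<Rightarrow> real" where "g = (\<lambda>c. 1 / (16 * real c) - 1 / (16 * real (Suc c)))"
  have "(\<lambda>c. 1 / (16 * real (Suc c)) - 1 / (16 * real (Suc (Suc c)))) sums (1 / (16 * real (Suc 0)) - 0)"
    by (rule telescope_sums') real_asymp
  hence g: "(\<lambda>c. g (Suc c)) sums (1 / 16)"
    by (simp add: g_def)
  have "(\<lambda>c. 1 / real (Suc c) ^ m) sums zeta_sum m"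
    using assms by (intro zeta_sum_sums) auto
  hence sums: "(\<lambda>c. 1 / real (Suc (Suc c)) ^ m) sums (zeta_sum m - 1)"
    by (subst sums_Suc_iff) simp
  have le: "1 / real (Suc (Suc c)) ^ m \<le> g (Suc c)" for c
  proof -
    define x where "x = real (Suc c)"
    have x: "x \<ge> 1" by (simp add: x_def)
    have "16 * (x * (x + 1)) \<le> (x + 1) ^ 4 * ((x + 1) * (x + 1))"
      using x power_mono[of 2 "x + 1" 4] by (intro mult_mono) auto
    also have "\<dots> = (x + 1) ^ 6" by (simp add: eval_nat_numeral)
    also have "\<dots> \<le> (x + 1) ^ m" using assms x by (intro power_increasing) auto
    finally have "1 / (x + 1) ^ m \<le> 1 / (16 * (x * (x + 1)))"
      using x by (intro divide_left_mono) auto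
    also have "\<dots> = 1 / (16 * x) - 1 / (16 * (x + 1))"
      using x by (simp add: field_simps)
    finally show ?thesis by (simp add: g_def x_def add_ac)
  qed
  have "zeta_sum m - 1 \<le> 1 / 16"
    by (rule sums_le[OF le sums g])
  thus ?thesis by simp
qed

section \<open>The arc parameter and the normalised Eisenstein series\<close>

text \<open>Here \<open>Re u / (2 n)\<close> is the clockwise angle of the point from the vertical
  and \<open>Im u / (2 n)\<close> the logarithm of its norm. The unit arc is thus the image of real
  u, starting at \<open>\<i>\<close> for \<open>u = 0\<close>.\<close>

definition arc_param :: "nat \<Rightarrow> complex \<Rightarrow> complex" where
  "arc_param n u = \<i> * exp (- \<i> * u / of_nat (2 * n))"

lemma arc_param:
  shows "norm (arc_param n u) = exp (Im u / (2 * real n))"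
    and "Re (arc_param n u) = exp (Im u / (2 * real n)) * sin (Re u / (2 * real n))"
    and "Im (arc_param n u) = exp (Im u / (2 * real n)) * cos (Re u / (2 * real n))"
proof -
  have *: "- \<i> * u / of_nat (2 * n) = (- \<i> * u) / of_real (2 * real n)" by simp
  show "norm (arc_param n u) = exp (Im u / (2 * real n))"
    and "Re (arc_param n u) = exp (Im u / (2 * real n)) * sin (Re u / (2 * real n))"
    and "Im (arc_param n u) = exp (Im u / (2 * real n)) * cos (Re u / (2 * real n))"
    unfolding arc_param_def * by (simp_all add: norm_mult Re_exp Im_exp Re_divide_of_real Im_divide_of_real del: of_real_of_nat_eq)
qed

lemma arc_param_power:
  assumes "n > 0"
  shows "arc_param n u ^ (4 * n) = exp (- 2 * \<i> * u)"
proof -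
  have "exp (- \<i> * u / of_nat (2 * n)) ^ (4 * n) = exp (of_nat (4 * n) * (- \<i> * u / of_nat (2 * n)))"
    by (rule exp_of_nat_mult [symmetric])
  also have "of_nat (4 * n) * (- \<i> * u / of_nat (2 * n)) = - 2 * \<i> * u"
    using assms by (simp add: field_simps)
  finally show ?thesis
    by (simp add: arc_param_def power_mult_distrib power_mult)
qed

text \<open>Rankin and Swinnerton-Dyer's normalisation: real on the unit arc, and close to \<open>2 cos u\<close>.\<close>
definition rsd_function :: "nat \<Rightarrow> complex \<Rightarrow> complex" where
  "rsd_function n u = exp (- \<i> * u) * eisenstein_E (4 * n) (arc_param n u)"

text \<open>The factor \<open>exp (- \<i> * u)\<close> turns \<open>1 + 1 / z ^ (4 * n)\<close> into
  \<open>2 * cos u\<close> and has norm \<open>norm z ^ (2 * n)\<close>, which cancels the powers of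
  \<open>norm z\<close> in the lattice bound. The bases are the inverse squares of 2 and of
  \<open>1.06 = 2 * (1 - 0.47)\<close>.\<close>

lemma rsd_function_approx_geometric:
  assumes "n \<ge> 3" "Im (arc_param n u) > 0" "Re (arc_param n u) \<ge> 0"
    "Re (arc_param n u) \<le> 47 / 100 * norm (arc_param n u)"
  shows "norm (rsd_function n u - 2 * cos u) \<le> (17 / 16) ^ 2 * ((1 / 4) ^ n + (2500 / 2809) ^ n)"
proof -
  define z where "z = arc_param n u"
  define Q where "Q = lattice_sum (4 * n) z"
  have z: "Im z > 0" "Re z \<ge> 0" "Re z \<le> 47 / 100 * norm z" using assms by (simp_all add: z_def)
  have nz: "norm z > 0" using z(1) by auto
  have zeta: "zeta_sum (4 * n) \<ge> 1" "zeta_sum (2 * n) \<ge> 1" "zeta_sum (2 * n) \<le> 17 / 16"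
    by (rule zeta_sum_ge_1 zeta_sum_le, use assms(1) in simp)+
  have "eisenstein_E (4 * n) z = 1 + 1 / z ^ (4 * n) + Q / of_real (zeta_sum (4 * n))"
    unfolding Q_def by (rule eisenstein_E_lattice_sum) (use assms z in auto)
  moreover have "exp (- \<i> * u) * (1 / z ^ (4 * n)) = exp (\<i> * u)"
  proof -
    have "exp (- \<i> * u) * (1 / z ^ (4 * n)) = exp (- \<i> * u - - 2 * \<i> * u)"
      using assms(1) unfolding z_def exp_diff by (subst arc_param_power) simp_all
    thus ?thesis by simp
  qed
  ultimately have "rsd_function n u - 2 * cos u = exp (- \<i> * u) * Q / of_real (zeta_sum (4 * n))"
    by (simp add: rsd_function_def z_def [symmetric] distrib_left cos_exp_eq add_divide_distrib)
  hence "norm (rsd_function n u - 2 * cos u) = norm (exp (- \<i> * u)) * norm Q / zeta_sum (4 * n)"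
    using zeta by (simp add: norm_mult norm_divide)
  also have "norm (exp (- \<i> * u)) = norm z ^ (2 * n)"
    using assms(1) by (simp add: z_def arc_param exp_of_nat_mult [symmetric] norm_exp_eq_Re)
  also have "norm z ^ (2 * n) * norm Q / zeta_sum (4 * n) \<le> norm z ^ (2 * n) * norm Q / 1"
    using zeta by (intro divide_left_mono) auto
  also have "norm Q \<le> (1 / (2 * (norm z + Re z)) ^ (2 * n) + 1 / (2 * (norm z - Re z)) ^ (2 * n)) * zeta_sum (2 * n) ^ 2"
    using lattice_sum_bound(2)[OF z(1), of "2 * n"] assms(1) by (simp add: Q_def)
  also have "\<dots> \<le> (1 / (2 * norm z) ^ (2 * n) + 1 / ((106 / 100) * norm z) ^ (2 * n)) * (17 / 16) ^ 2"
  proof -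
    have "2 * norm z \<le> 2 * (norm z + Re z)" "(106 / 100) * norm z \<le> 2 * (norm z - Re z)"
      using z by auto
    hence "1 / (2 * (norm z + Re z)) ^ (2 * n) \<le> 1 / (2 * norm z) ^ (2 * n)"
      "1 / (2 * (norm z - Re z)) ^ (2 * n) \<le> 1 / ((106 / 100) * norm z) ^ (2 * n)"
      using nz by (intro frac_le power_mono zero_less_power; simp)+
    moreover have "zeta_sum (2 * n) ^ 2 \<le> (17 / 16) ^ 2"
      using zeta by (intro power_mono) auto
    moreover have "0 \<le> 1 / (2 * norm z) ^ (2 * n) + 1 / ((106 / 100) * norm z) ^ (2 * n)"
      using nz by (intro add_nonneg_nonneg divide_nonneg_nonneg zero_le_power) auto
    ultimately show ?thesis
      by (intro mult_mono add_mono) simp_all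
  qed
  also have "norm z ^ (2 * n) * ((1 / (2 * norm z) ^ (2 * n) + 1 / ((106 / 100) * norm z) ^ (2 * n)) * (17 / 16) ^ 2) / 1
               = (1 / 2 ^ (2 * n) + 1 / (106 / 100) ^ (2 * n)) * (17 / 16) ^ 2"
  proof -
    have *: "N * ((1 / (x * N) + 1 / (y * N)) * c) / 1 = (1 / x + 1 / y) * c" if "N > 0" for N x y c :: real
      using that by (simp add: distrib_left distrib_right)
    show ?thesis
      unfolding power_mult_distrib by (rule *) (use nz in simp)
  qed
  also have "\<dots> = (17 / 16) ^ 2 * ((1 / 4) ^ n + (2500 / 2809) ^ n)"
    by (simp add: power_mult power_divide power2_eq_square)
  finally show ?thesis by (simp add: mult_left_mono)
qed

text \<open>The geometric bound decreases in n and is below 0.82 at \<open>n = 3\<close>. The bound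
  decaying like \<open>1 / n\<close> follows from
  \<open>1.06 ^ (2 * n) \<ge> (1 + 0.06 n)^2 \<ge> 0.24 n\<close> and
  \<open>4 ^ n \<ge> 21 n\<close>.\<close>

lemma rsd_function_approx:
  assumes "n \<ge> 3" "Im (arc_param n u) > 0" "Re (arc_param n u) \<ge> 0"
    "Re (arc_param n u) \<le> 47 / 100 * norm (arc_param n u)"
  shows "norm (rsd_function n u - 2 * cos u) \<le> 82 / 100"
    and "norm (rsd_function n u - 2 * cos u) \<le> 48 / 10 / n"
proof -
  note raw = rsd_function_approx_geometric[OF assms]
  have "(1 / 4 :: real) ^ n \<le> (1 / 4) ^ 3" "(2500 / 2809 :: real) ^ n \<le> (2500 / 2809) ^ 3"
    using assms(1) by (intro power_decreasing; simp)+
  hence "(17 / 16 :: real) ^ 2 * ((1 / 4) ^ n + (2500 / 2809) ^ n) \<le> (17 / 16) ^ 2 * ((1 / 4) ^ 3 + (2500 / 2809) ^ 3)"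
    by (intro mult_left_mono add_mono) auto
  also have "\<dots> \<le> 82 / 100" by (simp add: power_divide)
  finally show "norm (rsd_function n u - 2 * cos u) \<le> 82 / 100" using raw by simp
  have n: "real n \<ge> 3" using assms(1) by simp
  define b c :: real where "b = (2809 / 2500) ^ n" and "c = 4 ^ n"
  have pos: "b > 0" "c > 0" by (simp_all add: b_def c_def)
  have c: "21 * real n \<le> c"
    unfolding c_def using assms(1)
  proof (induction n rule: dec_induct)
    case (step m)
    hence "21 * real (Suc m) \<le> 4 * (21 * real m)" by simp
    also have "\<dots> \<le> 4 * 4 ^ m" using step.IH by (intro mult_left_mono) auto
    finally show ?case by simp
  qed simp
  have "1 + real n * (6 / 100) \<le> (1 + 6 / 100) ^ n"
    by (rule Bernoulli_inequality) auto
  hence "(1 + real n * (6 / 100)) ^ 2 \<le> ((1 + 6 / 100) ^ n) ^ 2"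
    by (intro power_mono) auto
  also have "\<dots> = ((1 + 6 / 100) ^ 2) ^ n"
    by (simp only: power_mult [symmetric] mult.commute)
  also have "(1 + 6 / 100) ^ 2 = (2809 / 2500 :: real)"
    by (simp add: power2_eq_square)
  finally have "(1 + real n * (6 / 100)) ^ 2 \<le> b" by (simp only: b_def)
  moreover have "4 * y \<le> (1 + y) ^ 2" for y :: real
    using zero_le_power2[of "1 - y"] by (simp add: power2_eq_square algebra_simps)
  from this[of "real n * (6 / 100)"] calculation have b: "24 / 100 * real n \<le> b"
    by linarith
  have "(1 / 4 :: real) ^ n = 1 / c" "(2500 / 2809 :: real) ^ n = 1 / b"
    by (simp_all add: b_def c_def power_divide)
  moreover have "1 / c \<le> 1 / (21 * real n)" "1 / b \<le> 1 / (24 / 100 * real n)"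
    using b c n by (intro frac_le; simp)+
  ultimately have "(17 / 16 :: real) ^ 2 * ((1 / 4) ^ n + (2500 / 2809) ^ n)
                     \<le> (17 / 16) ^ 2 * (1 / (21 * real n) + 1 / (24 / 100 * real n))"
    by (intro mult_left_mono add_mono) simp_all
  also have "\<dots> = (17 / 16) ^ 2 * (1 / 21 + 100 / 24) / n"
    by (simp add: add_divide_distrib)
  also have "\<dots> \<le> 48 / 10 / n"
    by (intro divide_right_mono) (auto simp: power2_eq_square)
  finally show "norm (rsd_function n u - 2 * cos u) \<le> 48 / 10 / n" using raw by linarith
qed

text \<open>The angle is at most \<open>2.8 / 6 < 0.47\<close>, and a nonnegative angle bounds its
  sine.\<close>

lemma arc_param_strip:
  assumes "n \<ge> 3" "Re u \<ge> 0" "Re u \<le> 28 / 10"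
  shows "Im (arc_param n u) > 0" "Re (arc_param n u) \<ge> 0"
    "Re (arc_param n u) \<le> 47 / 100 * norm (arc_param n u)"
proof -
  define a where "a = Re u / (2 * real n)"
  have n: "real n \<ge> 3" using assms(1) by simp
  have "a \<le> (28 / 10) / (2 * 3)"
    unfolding a_def using assms n by (intro frac_le) auto
  hence a: "a \<ge> 0" "a \<le> 47 / 100" using assms by (auto simp: a_def)
  have "cos a > 0" using a pi_gt3 by (intro cos_gt_zero_pi) auto
  moreover have "sin a \<ge> 0" using a pi_gt3 by (intro sin_ge_zero) auto
  moreover have "sin a \<le> 47 / 100" using sin_x_le_x[of a] a by simp
  ultimately show "Im (arc_param n u) > 0" "Re (arc_param n u) \<ge> 0"
    "Re (arc_param n u) \<le> 47 / 100 * norm (arc_param n u)"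
    by (simp_all add: arc_param a_def [symmetric])
qed

text \<open>At a zero the first summand drops out, so a nonzero derivative there forces the value of
  \<open>theta_eisenstein\<close> to be nonzero.\<close>

lemma has_field_derivative_rsd_function:
  assumes "n \<ge> 3" "Im (arc_param n u) > 0"
  shows "(rsd_function n has_field_derivative
           - \<i> * rsd_function n u + exp (- \<i> * u) *
             (2 * of_real pi * \<i> * theta_eisenstein (4 * n) (nome (arc_param n u)) *
                (- \<i> / of_nat (2 * n) * arc_param n u))) (at u)"
proof -
  have "fps_conv_radius (eisenstein_fps (4 * n)) \<ge> 1"
    by (rule fps_conv_radius_eisenstein) (use assms(1) in simp)
  moreover have "ereal (norm (nome (arc_param n u))) < 1"
    using norm_nome_less_1[OF assms(2)] by simp
  ultimately have "ereal (norm (nome (arc_param n u))) < fps_conv_radius (eisenstein_fps (4 * n))"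
    by (rule less_le_trans [rotated])
  hence D: "((\<lambda>z. eval_fps (eisenstein_fps (4 * n)) (nome z)) has_field_derivative
            2 * of_real pi * \<i> * theta_eisenstein (4 * n) (nome (arc_param n u))) (at (arc_param n u))"
    unfolding theta_eisenstein_def by (rule has_field_derivative_eval_fps_nome)
  have "(arc_param n has_field_derivative (- \<i> / of_nat (2 * n) * arc_param n u)) (at u)"
    unfolding arc_param_def using assms(1)
    by (auto intro!: derivative_eq_intros simp: mult.assoc)
  note E = DERIV_chain2[OF D this]
  have "((\<lambda>u. exp (- \<i> * u)) has_field_derivative exp (- \<i> * u) * (- \<i>)) (at u)"
    by (auto intro!: derivative_eq_intros)
  from DERIV_mult'[OF this E] show ?thesis
    unfolding rsd_function_def [abs_def] eisenstein_E_def
    by (rule DERIV_cong) (simp add: mult_ac)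
qed

text \<open>On the unit circle \<open>- cnj z = -1 / z\<close>, so reflection and inversion together
  give \<open>cnj E = z ^ (4 * n) * E\<close>, with
  \<open>z ^ (4 * n) = exp (- 2 * \<i> * u)\<close>. Multiplying E by the square root
  \<open>exp (- \<i> * u)\<close> of this factor makes it real.\<close>

lemma rsd_function_of_real_in_Reals:
  assumes "n \<ge> 3" "Im (arc_param n (of_real x)) > 0"
  shows "rsd_function n (of_real x) \<in> \<real>"
proof -
  define z where "z = arc_param n (of_real x)"
  have z: "Im z > 0" "norm z = 1" using assms by (simp_all add: z_def arc_param)
  have "z * cnj z = 1" using z(2) by (simp add: complex_norm_square [symmetric])
  moreover have "z \<noteq> 0" using z by auto
  ultimately have c: "- cnj z = -1 / z" by (simp add: eq_divide_eq mult.commute)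
  have "cnj (eisenstein_E (4 * n) z) = eisenstein_E (4 * n) (- cnj z)"
    using assms z by (intro eisenstein_E_minus_cnj [symmetric]) auto
  also have "\<dots> = z ^ (4 * n) * eisenstein_E (4 * n) z"
    unfolding c using assms z by (intro eisenstein_E_inversion) auto
  also have "z ^ (4 * n) = exp (- 2 * \<i> * of_real x)"
    using assms(1) by (simp add: z_def arc_param_power)
  finally have E: "cnj (eisenstein_E (4 * n) z) = exp (- 2 * \<i> * of_real x) * eisenstein_E (4 * n) z" .
  have "cnj (rsd_function n (of_real x)) = cnj (exp (- \<i> * of_real x)) * exp (- 2 * \<i> * of_real x) * eisenstein_E (4 * n) z"
    unfolding rsd_function_def z_def [symmetric] complex_cnj_mult E by (rule mult.assoc [symmetric])
  also have "cnj (exp (- \<i> * of_real x)) = exp (\<i> * of_real x)"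
    by (simp add: exp_cnj)
  also have "exp (\<i> * of_real x) * exp (- 2 * \<i> * of_real x) = exp (\<i> * of_real x + - 2 * \<i> * of_real x)"
    by (rule exp_add [symmetric])
  also have "\<i> * of_real x + - 2 * \<i> * of_real x = - \<i> * of_real x"
    by simp
  finally show ?thesis
    unfolding rsd_function_def z_def [symmetric] Reals_cnj_iff .
qed

section \<open>Injectivity on a strip about \<open>pi / 2\<close>\<close>

text \<open>The Noshiro-Warschawski criterion. Dividing f by \<open>b - a\<close> makes the mean
  value theorem for real parts on a segment speak about \<open>Re (f' u)\<close> itself.\<close>

lemma inj_on_convex_Re_deriv_neg:
  assumes "convex S" and deriv: "\<And>z. z \<in> S \<Longrightarrow> (f has_field_derivative f' z) (at z)"
    and neg: "\<And>z. z \<in> S \<Longrightarrow> Re (f' z) < 0"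
  shows "inj_on f S"
proof (rule inj_onI, rule ccontr)
  fix a b assume ab: "a \<in> S" "b \<in> S" "f a = f b" "a \<noteq> b"
  have sub: "closed_segment a b \<subseteq> S"
    using ab \<open>convex S\<close> by (intro closed_segment_subset) auto
  have "\<exists>u. u \<in> closed_segment a b \<and> Re (f b / (b - a)) - Re (f a / (b - a)) = Re (f' u / (b - a) * (b - a))"
    by (rule complex_mvt_line) (use sub in \<open>auto intro!: DERIV_cdivide deriv\<close>)
  then obtain u where "u \<in> closed_segment a b" "Re (f' u / (b - a) * (b - a)) = 0"
    using ab(3) by auto
  with neg[of u] sub ab(4) show False by auto
qed

text \<open>Cauchy's estimate on discs of radius \<open>0.79\<close>, where the error is at most \<open>0.82\<close>, shows that the
  derivative of \<open>2 cos u\<close> dominates.\<close>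
lemma rsd_function_deriv_Re_neg:
  assumes "n \<ge> 3" "\<bar>Re u - pi / 2\<bar> \<le> 43 / 100"
  shows "(rsd_function n has_field_derivative deriv (rsd_function n) u) (at u)"
    and "Re (deriv (rsd_function n) u) < 0"
proof -
  define W where "W = {w. 0 < Re w \<and> Re w < 28 / 10}"
  define S where "S = (\<lambda>w. rsd_function n w - 2 * cos w)"
  have W: "open W"
    unfolding W_def by (intro open_Collect_conj open_halfspace_Re_gt open_halfspace_Re_lt)
  have pi: "3141 / 1000 \<le> pi" "pi \<le> 31416 / 10000" using pi_approx by simp_all
  have strip: "Im (arc_param n w) > 0" "Re (arc_param n w) \<ge> 0"
    "Re (arc_param n w) \<le> 47 / 100 * norm (arc_param n w)" if "w \<in> W" for w
    using that arc_param_strip[OF assms(1), of w] by (auto simp: W_def)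
  have D: "rsd_function n field_differentiable (at w)" if "w \<in> W" for w
    using has_field_derivative_rsd_function[OF assms(1) strip(1)[OF that]]
    by (auto simp: field_differentiable_def)
  have hol: "S holomorphic_on W"
    unfolding S_def
    by (intro holomorphic_intros) (use D in \<open>auto simp: holomorphic_on_def intro: field_differentiable_at_within\<close>)
  \<comment> \<open>The margins suffice because \<open>0.43 + 0.79 = 1.22\<close>, while
    \<open>pi / 2 - 1.22 > 0\<close> and \<open>pi / 2 + 1.22 < 2.8\<close>.\<close>
  have cb: "cball u (79 / 100) \<subseteq> W"
  proof
    fix w assume "w \<in> cball u (79 / 100)"
    hence "\<bar>Re w - Re u\<bar> \<le> 79 / 100"
      using abs_Re_le_cmod[of "w - u"] by (simp add: dist_norm norm_minus_commute)
    with assms(2) pi show "w \<in> W" unfolding W_def mem_Collect_eq abs_le_iff by auto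
  qed
  hence u: "u \<in> W" by auto
  from D[OF u] show D': "(rsd_function n has_field_derivative deriv (rsd_function n) u) (at u)"
    by (simp add: field_differentiable_derivI)
  have "norm ((deriv ^^ 1) S u) \<le> fact 1 * (82 / 100) / (79 / 100) ^ 1"
  proof (rule Cauchy_inequality)
    show "S holomorphic_on ball u (79 / 100)"
      using cb ball_subset_cball by (intro holomorphic_on_subset[OF hol]) blast
    show "continuous_on (cball u (79 / 100)) S"
      using cb by (intro holomorphic_on_imp_continuous_on holomorphic_on_subset[OF hol])
    show "norm (S w) \<le> 82 / 100" if "norm (u - w) = 79 / 100" for w
    proof -
      have "w \<in> W" using that cb by (auto simp: dist_norm)
      thus ?thesis unfolding S_def by (intro rsd_function_approx(1) assms strip)
    qed
  qed auto
  moreover have "deriv S u = deriv (rsd_function n) u + 2 * sin u"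
    unfolding S_def using D' by (intro DERIV_imp_deriv) (auto intro!: derivative_eq_intros)
  ultimately have "norm (deriv (rsd_function n) u + 2 * sin u) \<le> 82 / 79"
    by simp
  hence "Re (deriv (rsd_function n) u) + 2 * Re (sin u) \<le> 82 / 79"
    using complex_Re_le_cmod[of "deriv (rsd_function n) u + 2 * sin u"] by simp
  \<comment> \<open>Since \<open>Re (sin u) = sin (Re u) * cosh (Im u)\<close>, the bound is uniform
    along the unbounded strip, and \<open>2 * 0.9\<close> exceeds \<open>82 / 79\<close>.\<close>
  moreover have "Re (sin u) \<ge> 9 / 10"
  proof -
    have "(Re u - pi / 2) ^ 2 \<le> (43 / 100) ^ 2"
      using assms(2) by (metis abs_ge_zero power2_abs power_mono)
    hence "cos (Re u - pi / 2) \<ge> 9 / 10"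
      using cos_ge_quadratic[of "Re u - pi / 2"] by (simp add: power_divide)
    hence 1: "sin (Re u) \<ge> 9 / 10" by (simp add: cos_diff)
    have 2: "(exp (Im u) + exp (- Im u)) / 2 \<ge> 1"
      using cosh_real_ge_1[of "Im u"] by (simp add: cosh_def)
    have "9 / 10 * 1 \<le> sin (Re u) * ((exp (Im u) + exp (- Im u)) / 2)"
      using 1 2 by (intro mult_mono) auto
    thus ?thesis by (simp add: Re_sin)
  qed
  ultimately show "Re (deriv (rsd_function n) u) < 0" by simp
qed

lemma rsd_function_inj_on:
  assumes "n \<ge> 3"
  shows "inj_on (rsd_function n) {u. \<bar>Re u - pi / 2\<bar> \<le> 43 / 100}"
proof (rule inj_on_convex_Re_deriv_neg)
  have "{u. \<bar>Re u - pi / 2\<bar> \<le> 43 / 100} = {u. Re u \<ge> pi / 2 - 43 / 100} \<inter> {u. Re u \<le> pi / 2 + 43 / 100}"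
    unfolding abs_le_iff by (rule set_eqI) (simp only: mem_Collect_eq Int_iff, linarith)
  thus "convex {u. \<bar>Re u - pi / 2\<bar> \<le> 43 / 100}"
    by (simp add: convex_Int convex_halfspace_Re_ge convex_halfspace_Re_le)
qed (use rsd_function_deriv_Re_neg[OF assms] in auto)

section \<open>Locating the zeros\<close>

text \<open>On \<open>[0, pi]\<close> this is monotonicity of the cosine and
  \<open>sin 0.43 > 0.41\<close>. Past pi, the limit 4.1 keeps x within 1 of pi, where
  \<open>\<bar>cos x\<bar> \<ge> 1 / 2\<close>; the next zero of the cosine is not yet near.\<close>

lemma near_pi_half_if_cos_small:
  assumes "0 \<le> x" "x \<le> 41 / 10" "\<bar>cos x\<bar> \<le> 41 / 100"
  shows "\<bar>x - pi / 2\<bar> \<le> 43 / 100"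
proof (rule ccontr)
  assume neg: "\<not> ?thesis"
  have pi: "31415 / 10000 \<le> pi" "pi \<le> 31416 / 10000" using pi_approx by simp_all
  consider "x < pi / 2 - 43 / 100" | "pi / 2 + 43 / 100 < x" "x \<le> pi" | "x > pi"
    using neg by linarith
  thus False
  proof cases
    case 1
    have "cos (pi / 2 - 43 / 100) < cos x"
      using 1 assms(1) pi by (intro cos_monotone_0_pi) auto
    thus False using assms(3) sin_43_100_gt by (simp add: cos_diff)
  next
    case 2
    have "cos x < cos (pi / 2 + 43 / 100)"
      using 2 pi by (intro cos_monotone_0_pi) auto
    thus False using assms(3) sin_43_100_gt by (simp add: cos_add)
  next
    case 3
    have "(x - pi) ^ 2 \<le> 1 ^ 2"
      using 3 assms(2) pi by (intro power_mono) auto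
    hence "cos (x - pi) \<ge> 1 / 2" using cos_ge_quadratic[of "x - pi"] by simp
    thus False using assms(3) by (simp add: cos_diff)
  qed
qed

text \<open>At a zero the approximation error is \<open>2 * norm (cos u)\<close> itself. The last
  two bounds come from \<open>norm (cos u)^2 = cos (Re u)^2 + sinh (Im u)^2\<close>.\<close>

lemma norm_cos_le_if_rsd_function_zero:
  assumes "n \<ge> 3" "rsd_function n u = 0" "Im (arc_param n u) > 0" "Re (arc_param n u) \<ge> 0"
    "Re (arc_param n u) \<le> 47 / 100 * norm (arc_param n u)"
  shows "norm (cos u) \<le> 41 / 100" "norm (cos u) \<le> 24 / 10 / n"
    "\<bar>cos (Re u)\<bar> \<le> norm (cos u)" "Im u \<ge> 0 \<Longrightarrow> Im u \<le> norm (cos u)"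
proof -
  show "norm (cos u) \<le> 41 / 100" "norm (cos u) \<le> 24 / 10 / n"
    using rsd_function_approx[OF assms(1,3-)] assms(2) by (simp_all add: norm_mult)
  have eq: "norm (cos u) ^ 2 = cos (Re u) ^ 2 + sinh (Im u) ^ 2"
    by (simp add: norm_cos_squared sinh_def exp_minus power_divide)
  show "\<bar>cos (Re u)\<bar> \<le> norm (cos u)"
    by (rule power2_le_imp_le) (simp_all add: eq)
  assume "Im u \<ge> 0"
  have "sinh (Im u) \<le> norm (cos u)"
    by (rule power2_le_imp_le) (simp_all add: eq)
  thus "Im u \<le> norm (cos u)"
    using real_le_x_sinh[OF \<open>Im u \<ge> 0\<close>] by (simp add: sinh_def exp_minus)
qed

text \<open>This cosine is the height of the arc point with parameter \<open>2 * pi / 3\<close>, a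
  lower bound for the height of the zero found on the arc. The constant 0.5484 slightly exceeds
  \<open>pi^2 / 18\<close>.\<close>

lemma cos_pi_3n_ge:
  assumes "n \<ge> 3"
  shows "cos (pi / (3 * real n)) \<ge> 1 - 5484 / 10000 / real n ^ 2" "cos (pi / (3 * real n)) \<ge> 93906 / 100000"
proof -
  have "pi ^ 2 \<le> (31416 / 10000) ^ 2"
    using pi_approx pi_gt_zero by (intro power_mono) auto
  hence "pi ^ 2 / 18 \<le> 5484 / 10000"
    by (simp add: power_divide)
  hence "pi ^ 2 / 18 / real n ^ 2 \<le> 5484 / 10000 / real n ^ 2"
    by (intro divide_right_mono) auto
  also have "pi ^ 2 / 18 / real n ^ 2 = (pi / (3 * real n)) ^ 2 / 2"
    by (simp add: power_divide power_mult_distrib)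
  finally show *: "cos (pi / (3 * real n)) \<ge> 1 - 5484 / 10000 / real n ^ 2"
    using cos_ge_quadratic[of "pi / (3 * real n)"] by simp
  have "real n ^ 2 \<ge> 3 ^ 2" using assms by (intro power_mono) auto
  hence "5484 / 10000 / real n ^ 2 \<le> 5484 / 10000 / 3 ^ 2"
    using assms by (intro divide_left_mono) auto
  with * show "cos (pi / (3 * real n)) \<ge> 93906 / 100000" by simp
qed

text \<open>At a zero, \<open>|cos u|\<close> is \<open>O(1/n)\<close>, so \<open>ln |z| = Im u / (2n)\<close> is \<open>O(1/n\<^sup>2)\<close>. The lower bound on
  \<open>Im z\<close> then keeps the angle of \<open>z\<close> from the vertical below \<open>2.05/n\<close>, which is less than that of
  the second zero on the arc.\<close>
lemma eisenstein_zero_param: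
  assumes n: "n \<ge> 3" and zero: "eisenstein_E (4 * n) z = 0"
    and z: "norm z \<ge> 1" "0 \<le> Re z" "Re z \<le> 1 / 2" "Im z \<ge> cos (pi / (3 * real n))"
  obtains u where "z = arc_param n u" "rsd_function n u = 0" "\<bar>Re u - pi / 2\<bar> \<le> 43 / 100"
proof -
  have n': "real n \<ge> 3" using n by simp
  have Im: "Im z \<ge> 93906 / 100000" using cos_pi_3n_ge[OF n] z(4) by simp
  define u where "u = of_nat (2 * n) * \<i> * Ln (- \<i> * z)"
  have nz: "- \<i> * z \<noteq> 0" using Im by auto
  have "- \<i> * u / of_nat (2 * n) = Ln (- \<i> * z)"
    using n by (simp add: u_def)
  hence zu: "z = arc_param n u"
    unfolding arc_param_def using exp_Ln[OF nz] by simp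
  have T0: "rsd_function n u = 0"
    using zero by (simp add: rsd_function_def zu [symmetric])
  \<comment> \<open>The extreme case \<open>Re z = 1/2\<close>, \<open>Im z = 0.93906\<close> only
    just satisfies the ratio 0.47.\<close>
  have Re47: "Re z \<le> 47 / 100 * norm z"
  proof (rule power2_le_imp_le)
    have "Re z ^ 2 \<le> (1 / 2) ^ 2" "(93906 / 100000) ^ 2 \<le> Im z ^ 2"
      using z Im by (intro power_mono; simp)+
    thus "Re z ^ 2 \<le> (47 / 100 * norm z) ^ 2"
      unfolding power_mult_distrib cmod_power2 by (simp add: power_divide)
  qed auto
  note cosb = norm_cos_le_if_rsd_function_zero[OF n T0, folded zu, OF _ z(2) Re47]
  have Im0: "Im z > 0" using Im by simp
  define a where "a = Re u / (2 * real n)"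
  have Imu: "Im u = 2 * real n * ln (norm z)" and Reu: "Re u = - 2 * real n * Im (Ln (- \<i> * z))"
    using nz by (simp_all add: u_def norm_mult)
  have a: "a = - Im (Ln (- \<i> * z))"
    using n' by (simp add: a_def Reu)
  have apos: "a \<ge> 0" "a < pi / 2"
  proof -
    have "\<bar>Im (Ln (- \<i> * z))\<bar> < pi / 2"
      using Re_Ln_pos_lt[OF nz] Im0 by simp
    thus "a < pi / 2" unfolding a by simp
    have "sin a \<ge> 0"
      using z(2) arc_param(2)[of n u] unfolding zu [symmetric] a_def [symmetric]
      by (simp add: zero_le_mult_iff)
    moreover have "sin (- a) > 0" if "a < 0"
      using that \<open>\<bar>Im (Ln (- \<i> * z))\<bar> < pi / 2\<close> a by (intro sin_gt_zero) auto
    ultimately show "a \<ge> 0" by force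
  qed
  have "Im u \<ge> 0" unfolding Imu using z(1) by simp
  hence V: "Im u \<le> 24 / 10 / n"
    using cosb(2,4)[OF Im0] by simp
  have "a * real n < 205 / 100"
  proof (rule ccontr)
    assume neg: "\<not> a * real n < 205 / 100"
    \<comment> \<open>An angle of at least \<open>b\<close> gives
      \<open>cos a \<le> 1 - 2 / n^2\<close>, whereas the height bound and the estimate of
      \<open>Im u\<close> give \<open>cos a \<ge> 1 - (1.2 + 0.5484) / n^2\<close>.\<close>
    define b where "b = 205 / 100 / real n"
    have b: "b \<le> a" "b \<ge> 0" using n' neg by (auto simp: b_def field_simps)
    have "cos a \<le> cos b"
      using b apos by (intro cos_monotone_0_pi_le) auto
    also have "\<dots> \<le> 1 - b ^ 2 / 2 + b ^ 4 / 24" by (rule cos_le_quartic)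
    also have "b ^ 4 \<le> (205 / 100 / 3) ^ 2 * b ^ 2"
    proof -
      have "b \<le> 205 / 100 / 3" unfolding b_def using n' by (intro divide_left_mono) auto
      hence "b ^ 2 * b ^ 2 \<le> (205 / 100 / 3) ^ 2 * b ^ 2"
        using b by (intro mult_right_mono power_mono) auto
      thus ?thesis by (simp add: power2_eq_square power4_eq_xxxx mult_ac)
    qed
    finally have "cos a \<le> 1 - (1 / 2 - (205 / 100 / 3) ^ 2 / 24) * b ^ 2"
      by (simp add: algebra_simps)
    also have "b ^ 2 = (205 / 100) ^ 2 / real n ^ 2" by (simp add: b_def power_divide)
    finally have "cos a \<le> 1 - (1 / 2 - (205 / 100 / 3) ^ 2 / 24) * (205 / 100) ^ 2 / real n ^ 2"
      by simp
    moreover have "2 / real n ^ 2 \<le> (1 / 2 - (205 / 100 / 3) ^ 2 / 24) * (205 / 100) ^ 2 / real n ^ 2"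
      by (rule divide_right_mono) (simp_all add: power2_eq_square)
    ultimately have up: "cos a \<le> 1 - 2 / real n ^ 2" by linarith
    define y where "y = 12 / 10 / real n ^ 2"
    have "Im u / (2 * real n) \<le> (24 / 10 / n) / (2 * real n)"
      using V n' by (intro divide_right_mono) auto
    hence y: "Im u / (2 * real n) \<le> y"
      by (simp add: y_def power2_eq_square)
    have cpos: "cos a > 0" using apos by (intro cos_gt_zero_pi) auto
    have "cos (pi / (3 * real n)) \<le> exp (Im u / (2 * real n)) * cos a"
      using z(4) arc_param(3)[of n u] by (simp add: zu [symmetric] a_def)
    also have "\<dots> \<le> exp y * cos a"
      using y cpos by (intro mult_right_mono) auto
    finally have "exp (- y) * cos (pi / (3 * real n)) \<le> exp (- y) * (exp y * cos a)"
      by (intro mult_left_mono) auto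
    also have "exp (- y) * (exp y * cos a) = cos a"
      by (simp add: exp_minus)
    finally have lo: "exp (- y) * cos (pi / (3 * real n)) \<le> cos a" .
    have n2: "real n ^ 2 \<ge> 3 ^ 2" using n' by (intro power_mono) auto
    have ypos: "0 \<le> y" "y \<le> 1"
      using n2 n' by (auto simp: y_def divide_simps)
    define w where "w = 5484 / 10000 / real n ^ 2"
    have w: "0 \<le> w" "w \<le> 1" using n2 n' by (auto simp: w_def divide_simps)
    have "(1 - y) * (1 - w) \<le> exp (- y) * cos (pi / (3 * real n))"
      using exp_ge_add_one_self[of "- y"] cos_pi_3n_ge(1)[OF n] ypos w
      unfolding w_def [symmetric] by (intro mult_mono) auto
    moreover have "1 - y - w \<le> (1 - y) * (1 - w)"
      using ypos w mult_nonneg_nonneg[of y w] by (simp add: algebra_simps)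
    ultimately have "1 - y - w \<le> 1 - 2 / real n ^ 2"
      using lo up by linarith
    hence "2 / real n ^ 2 \<le> (12 / 10 + 5484 / 10000) / real n ^ 2"
      by (simp add: y_def w_def)
    moreover have "(12 / 10 + 5484 / 10000) / real n ^ 2 < 2 / real n ^ 2"
      using n' by (intro divide_strict_right_mono) auto
    ultimately show False by linarith
  qed
  \<comment> \<open>Twice 2.05, because \<open>Re u = 2 * n * a\<close>.\<close>
  hence "Re u \<le> 41 / 10"
    using n' by (simp add: a_def)
  moreover have "Re u \<ge> 0"
    using apos(1) n' by (simp add: a_def zero_le_divide_iff)
  ultimately have "\<bar>Re u - pi / 2\<bar> \<le> 43 / 100"
    using cosb(1,3)[OF Im0] by (intro near_pi_half_if_cos_small) auto
  with zu T0 show ?thesis using that by blast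
qed

text \<open>Existence comes from the intermediate value theorem, uniqueness from injectivity on the
  strip, and simplicity from the nonzero derivative there.\<close>

lemma eisenstein_zero_on_arc:
  assumes n: "n \<ge> 3"
  obtains z where "norm z = 1" "0 < Re z" "Re z < 1 / 2" "Im z \<ge> cos (pi / (3 * real n))"
    "eisenstein_E (4 * n) z = 0" "theta_eisenstein (4 * n) (nome z) \<noteq> 0"
    "\<And>w. eisenstein_E (4 * n) w = 0 \<Longrightarrow> norm w \<ge> 1 \<Longrightarrow> 0 \<le> Re w \<Longrightarrow> Re w \<le> 1 / 2 \<Longrightarrow>
        Im w \<ge> cos (pi / (3 * real n)) \<Longrightarrow> w = z"
proof -
  have n': "real n \<ge> 3" using n by simp
  have pi: "31415 / 10000 \<le> pi" "pi \<le> 31416 / 10000" using pi_approx by simp_all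
  define f where "f = (\<lambda>x. Re (rsd_function n (of_real x)))"
  have strip: "Im (arc_param n (of_real x)) > 0" "Re (arc_param n (of_real x)) \<ge> 0"
    "Re (arc_param n (of_real x)) \<le> 47 / 100 * norm (arc_param n (of_real x))"
    if "0 \<le> x" "x \<le> 2 * pi / 3" for x
    using that pi arc_param_strip[OF n, of "of_real x"] by auto
  have approx: "\<bar>f x - 2 * cos x\<bar> \<le> 82 / 100" if "0 \<le> x" "x \<le> 2 * pi / 3" for x
  proof -
    have "\<bar>Re (rsd_function n (of_real x) - 2 * cos (of_real x))\<bar> \<le> 82 / 100"
      using rsd_function_approx(1)[OF n strip[OF that]] abs_Re_le_cmod order_trans by blast
    thus ?thesis by (simp add: f_def cos_of_real)
  qed
  have "continuous_on {0..2 * pi / 3} f"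
    unfolding f_def
  proof (intro continuous_on_Re continuous_at_imp_continuous_on ballI)
    fix x assume "x \<in> {0..2 * pi / 3}"
    hence "isCont (rsd_function n) (of_real x)"
      using has_field_derivative_rsd_function[OF n strip(1)] DERIV_isCont by auto
    thus "isCont (\<lambda>x. rsd_function n (of_real x)) x"
      by (rule isCont_o2[OF continuous_of_real[OF continuous_ident]])
  qed
  \<comment> \<open>The main terms 2 and -1 at the endpoints both outweigh the error 0.82, which
    forces a sign change.\<close>
  moreover have "\<bar>f 0 - 2 * cos 0\<bar> \<le> 82 / 100" "\<bar>f (2 * pi / 3) - 2 * cos (2 * pi / 3)\<bar> \<le> 82 / 100"
    by (rule approx; simp)+
  hence "f 0 \<ge> 0" "f (2 * pi / 3) \<le> 0"
    unfolding abs_le_iff cos_120 by simp_all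
  ultimately obtain x where x: "0 \<le> x" "x \<le> 2 * pi / 3" "f x = 0"
    using IVT2'[of f "2 * pi / 3" 0 0] by auto
  define z where "z = arc_param n (of_real x)"
  define a where "a = x / (2 * real n)"
  have T0: "rsd_function n (of_real x) = 0"
    using x(3) rsd_function_of_real_in_Reals[OF n strip(1)[OF x(1,2)]]
    by (auto simp: f_def complex_eq_iff complex_is_Real_iff)
  have zero: "eisenstein_E (4 * n) z = 0"
    using T0 by (simp add: rsd_function_def z_def)
  have "\<bar>cos x\<bar> \<le> 41 / 100"
    using norm_cos_le_if_rsd_function_zero(1,3)[OF n T0 strip[OF x(1,2)]] by simp
  hence x_strip: "\<bar>x - pi / 2\<bar> \<le> 43 / 100"
    using x pi by (intro near_pi_half_if_cos_small) auto
  hence "x > 0" using pi unfolding abs_le_iff by simp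
  hence "a > 0" using n' by (simp add: a_def)
  have a_le: "a \<le> pi / (3 * real n)"
    using x(2) n' by (simp add: a_def field_simps)
  have a_le': "pi / (3 * real n) \<le> 35 / 100"
  proof -
    have "pi / (3 * real n) \<le> pi / (3 * 3)"
      using n' by (intro divide_left_mono) auto
    thus ?thesis using pi by simp
  qed
  have z: "norm z = 1" "Re z = sin a" "Im z = cos a"
    by (simp_all add: z_def arc_param a_def)
  have uniq: "w = z" if w: "eisenstein_E (4 * n) w = 0" "norm w \<ge> 1" "0 \<le> Re w" "Re w \<le> 1 / 2"
      "Im w \<ge> cos (pi / (3 * real n))" for w
  proof -
    obtain u where u: "w = arc_param n u" "rsd_function n u = 0" "\<bar>Re u - pi / 2\<bar> \<le> 43 / 100"
      using eisenstein_zero_param[OF n w] by blast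
    have "u = of_real x"
      using inj_onD[OF rsd_function_inj_on[OF n], of u "of_real x"] u T0 x_strip by simp
    thus ?thesis by (simp add: u z_def)
  qed
  have "theta_eisenstein (4 * n) (nome z) \<noteq> 0"
  proof
    assume theta: "theta_eisenstein (4 * n) (nome z) = 0"
    have "(rsd_function n has_field_derivative 0) (at (of_real x))"
      using has_field_derivative_rsd_function[OF n strip(1)[OF x(1,2)]] theta
      by (simp add: T0 z_def)
    hence "deriv (rsd_function n) (of_real x) = 0" by (rule DERIV_imp_deriv)
    thus False using rsd_function_deriv_Re_neg(2)[OF n, of "of_real x"] x_strip by simp
  qed
  moreover have "sin a > 0" "sin a < 1 / 2"
    using \<open>a > 0\<close> a_le a_le' pi sin_gt_zero[of a] sin_x_le_x[of a] by auto
  moreover have "cos a \<ge> cos (pi / (3 * real n))"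
    using \<open>a > 0\<close> a_le a_le' pi by (intro cos_monotone_0_pi_le) auto
  ultimately show ?thesis
    by (intro that[of z] zero uniq) (simp_all add: z)
qed

section \<open>Coefficients of the reciprocal of a power series\<close>

text \<open>Consecutive differences have constant norm \<open>norm b * norm (w - 1)\<close>, so
  convergence forces \<open>b = 0\<close>. This rules out cancellation between the two poles on the
  circle of convergence.\<close>

lemma rotation_power_tendsto_0_imp:
  fixes a b w :: complex
  assumes "(\<lambda>n. a + b * w ^ n) \<longlonglongrightarrow> 0" "norm w = 1" "w \<noteq> 1"
  shows "b = 0"
proof -
  have "(\<lambda>n. (a + b * w ^ Suc n) - (a + b * w ^ n)) \<longlonglongrightarrow> 0 - 0"
    by (intro tendsto_diff assms(1) LIMSEQ_Suc[OF assms(1)])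
  hence "(\<lambda>n. norm ((a + b * w ^ Suc n) - (a + b * w ^ n))) \<longlonglongrightarrow> 0"
    by (simp add: tendsto_norm_zero)
  moreover have "norm ((a + b * w ^ Suc n) - (a + b * w ^ n)) = norm b * norm (w - 1)" for n
  proof -
    have "(a + b * w ^ Suc n) - (a + b * w ^ n) = b * w ^ n * (w - 1)"
      by (simp add: algebra_simps)
    thus ?thesis using assms(2) by (simp add: norm_mult norm_power)
  qed
  ultimately have "(\<lambda>n::nat. norm b * norm (w - 1)) \<longlonglongrightarrow> 0" by simp
  hence "norm b * norm (w - 1) = 0" by (simp add: LIMSEQ_const_iff)
  thus ?thesis using assms(3) by simp
qed

lemma has_fps_expansion_simple_pole:
  fixes c q :: complex
  assumes "q \<noteq> 0"
  shows "(\<lambda>z. c / (z - q)) has_fps_expansion Abs_fps (\<lambda>n. - (c / q) * (1 / q) ^ n)"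
proof (rule has_fps_expansionI)
  have "eventually (\<lambda>z. z \<in> ball 0 (norm q)) (nhds 0)"
    using assms by (intro eventually_nhds_in_open) auto
  thus "eventually (\<lambda>z. (\<lambda>n. fps_nth (Abs_fps (\<lambda>n. - (c / q) * (1 / q) ^ n)) n * z ^ n) sums (c / (z - q))) (nhds 0)"
  proof eventually_elim
    case (elim z)
    hence "norm (z / q) < 1" using assms by (simp add: norm_divide)
    hence "(\<lambda>n. - (c / q) * (z / q) ^ n) sums (- (c / q) * (1 / (1 - z / q)))"
      by (intro sums_mult geometric_sums)
    moreover have "- (c / q) * (1 / (1 - z / q)) = c / (z - q)"
      using elim assms by (auto simp: divide_simps) (simp add: algebra_simps)
    ultimately show ?case by (simp add: power_divide)
  qed
qed

text \<open>Dividing out both zeros leaves \<open>h\<close> without zeros on the closed disc, hence,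
  by compactness, on a larger open one. The remainder \<open>g\<close> is the second divided
  difference of \<open>1 / h\<close>.\<close>

lemma factor_two_simple_zeros:
  fixes f :: "complex \<Rightarrow> complex"
  assumes f: "f holomorphic_on ball 0 R" and r: "r < R" "a \<noteq> b" "norm a \<le> r" "norm b \<le> r"
    and zeros: "\<And>z. norm z \<le> r \<Longrightarrow> f z = 0 \<longleftrightarrow> z = a \<or> z = b"
    and simple: "deriv f a \<noteq> 0" "deriv f b \<noteq> 0"
  obtains r' g where "r < r'" "r' \<le> R" "g holomorphic_on ball 0 r'"
    "\<And>z. norm z < r' \<Longrightarrow> z \<noteq> a \<Longrightarrow> z \<noteq> b \<Longrightarrow>
        1 / f z = 1 / deriv f a / (z - a) + 1 / deriv f b / (z - b) + g z"
proof -
  have r0: "r \<ge> 0" using r(3) norm_ge_zero order_trans by blast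
  have f0: "f a = 0" "f b = 0" using zeros r by auto
  define h1 where "h1 = (\<lambda>z. if z = a then deriv f a else (f z - f a) / (z - a))"
  define h where "h = (\<lambda>z. if z = b then deriv h1 b else (h1 z - h1 b) / (z - b))"
  have h1: "h1 holomorphic_on ball 0 R"
    unfolding h1_def by (rule pole_lemma_open[OF f]) auto
  have h: "h holomorphic_on ball 0 R"
    unfolding h_def by (rule pole_lemma_open[OF h1]) auto
  have h1b: "h1 b = 0" using r(2) by (simp add: h1_def f0)
  have ha: "h a = deriv f a / (a - b)"
    using r(2) by (simp add: h_def h1b) (simp add: h1_def)
  have hb: "h b = deriv f b / (b - a)"
  proof -
    have "(f has_field_derivative deriv f b) (at b)"
      using r f by (intro holomorphic_derivI[of f "ball 0 R"]) auto
    hence "((\<lambda>z. f z / (z - a)) has_field_derivative (deriv f b / (b - a))) (at b)"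
      using r(2) by (auto intro!: derivative_eq_intros simp: f0 divide_simps)
    hence "(h1 has_field_derivative (deriv f b / (b - a))) (at b)"
      by (rule has_field_derivative_transform_within_open[where S = "- {a}"])
         (use r(2) in \<open>auto simp: h1_def f0\<close>)
    thus ?thesis by (simp add: h_def DERIV_imp_deriv)
  qed
  have hz: "f z = (z - a) * (z - b) * h z" if "z \<noteq> a" "z \<noteq> b" for z
    using that unfolding h_def h1b by (simp add: h1_def f0)
  have hnz: "h z \<noteq> 0" if "norm z \<le> r" for z
    using hz[of z] zeros[OF that] ha hb simple r(2) by (cases "z = a"; cases "z = b") auto
  define B where "B = ball 0 R \<inter> h -` (- {0})"
  have "open B" unfolding B_def
    by (intro continuous_open_preimage holomorphic_on_imp_continuous_on h) auto
  moreover have "cball 0 r \<subseteq> B" using hnz r(1) by (auto simp: B_def)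
  ultimately obtain e where e: "e > 0" "(\<Union>x\<in>cball 0 r. ball x e) \<subseteq> B"
    using compact_subset_open_imp_ball_epsilon_subset[of "cball 0 r" B] by auto
  define r' where "r' = min R (r + e)"
  have r': "r < r'" "r' \<le> R" using r(1) e(1) by (auto simp: r'_def)
  have hnz': "h z \<noteq> 0" if "norm z < r'" for z
  proof -
    have "\<exists>x\<in>cball 0 r. z \<in> ball x e"
    proof (cases "norm z \<le> r")
      case True
      thus ?thesis using e(1) by (intro bexI[of _ z]) auto
    next
      case False
      hence "norm z > 0" using r0 by linarith
      \<comment> \<open>Radial projection onto the circle of radius r, at distance
        \<open>norm z - r < e\<close>.\<close>
      define x where "x = (r / norm z) *\<^sub>R z"
      have "norm (x - z) = norm ((r / norm z - 1) *\<^sub>R z)"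
        by (simp add: x_def scaleR_left_diff_distrib)
      also have "\<dots> = \<bar>r / norm z - 1\<bar> * norm z" by simp
      also have "\<dots> = \<bar>(r / norm z - 1) * norm z\<bar>" by (simp only: abs_mult abs_norm_cancel)
      also have "(r / norm z - 1) * norm z = r - norm z"
        using \<open>norm z > 0\<close> by (simp add: algebra_simps)
      finally have "norm (x - z) < e" using that False by (auto simp: r'_def)
      moreover have "norm x = r" using \<open>norm z > 0\<close> r0 by (simp add: x_def)
      ultimately show ?thesis by (intro bexI[of _ x]) (auto simp: dist_norm)
    qed
    hence "z \<in> B" using e(2) by blast
    thus ?thesis by (simp add: B_def)
  qed
  define p where "p = (\<lambda>z. 1 / h z)"
  have p: "p holomorphic_on ball 0 r'"
    unfolding p_def using hnz' r'(2)
    by (intro holomorphic_intros holomorphic_on_subset[OF h]) auto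
  define g1 where "g1 = (\<lambda>z. if z = a then deriv p a else (p z - p a) / (z - a))"
  define g where "g = (\<lambda>z. if z = b then deriv g1 b else (g1 z - g1 b) / (z - b))"
  have g1: "g1 holomorphic_on ball 0 r'"
    unfolding g1_def by (rule pole_lemma_open[OF p]) auto
  have g: "g holomorphic_on ball 0 r'"
    unfolding g_def by (rule pole_lemma_open[OF g1]) auto
  have "1 / f z = 1 / deriv f a / (z - a) + 1 / deriv f b / (z - b) + g z"
    if "norm z < r'" "z \<noteq> a" "z \<noteq> b" for z
  proof -
    have pa: "1 / deriv f a = p a / (a - b)" "1 / deriv f b = p b / (b - a)"
      using r(2) by (simp_all add: p_def ha hb)
    have g1b: "g1 b = (p b - p a) / (b - a)" using r(2) by (simp add: g1_def)
    have "1 / f z = p z / ((z - a) * (z - b))"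
      using that by (simp add: hz p_def)
    also have "\<dots> = p a / (a - b) / (z - a) + p b / (b - a) / (z - b)
                     + ((p z - p a) / (z - a) - (p b - p a) / (b - a)) / (z - b)"
    proof -
      \<comment> \<open>Newton interpolation at a and b as a rational identity, with
        \<open>A = z - a\<close>, \<open>B = z - b\<close> and \<open>C = a - b\<close>.\<close>
      have *: "u / (A * B) = v / C / A + w / (- C) / B + ((u - v) / A - (w - v) / (- C)) / B"
        if "A \<noteq> 0" "B \<noteq> 0" "C \<noteq> 0" "B = A + C" for A B C u v w :: complex
      proof -
        have "v / C / A = v * B / (A * B * C)" "w / (- C) / B = - (w * A) / (A * B * C)"
          "(u - v) / A / B = (u - v) * C / (A * B * C)" "(w - v) / (- C) / B = - ((w - v) * A) / (A * B * C)"
          using that(1-3) by (simp_all add: mult_ac)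
        hence "v / C / A + w / (- C) / B + ((u - v) / A - (w - v) / (- C)) / B =
                (v * B - w * A + (u - v) * C + (w - v) * A) / (A * B * C)"
          by (simp only: diff_divide_distrib[of "(u - v) / A"]) (simp add: add_divide_distrib diff_divide_distrib)
        also have "v * B - w * A + (u - v) * C + (w - v) * A = u * C"
          using that(4) by (simp add: algebra_simps)
        finally show ?thesis using that(3) by simp
      qed
      show ?thesis
        by (rule *[of "z - a" "z - b" "a - b", unfolded minus_diff_eq]) (use that r(2) in auto)
    qed
    finally show ?thesis
      using that by (simp add: pa g_def g1b) (simp add: g1_def)
  qed
  with that r' g show ?thesis by blast
qed

text \<open>The residue of \<open>1 / F\<close> at a zero q is \<open>q / \<theta> q\<close>, so its
  principal part has coefficients \<open>- (1 / \<theta> q) * (1 / q) ^ n\<close>. The remainder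
  \<open>G\<close> converges beyond \<open>norm a\<close>, hence its coefficients times
  \<open>a ^ n\<close> tend to 0.\<close>

lemma inverse_fps_coeff_two_simple_zeros:
  fixes F :: "complex fps"
  assumes R: "fps_conv_radius F > ereal (norm a)" and ab: "norm b = norm a" "a \<noteq> b" "a \<noteq> 0"
    and zeros: "\<And>z. norm z \<le> norm a \<Longrightarrow> eval_fps F z = 0 \<longleftrightarrow> z = a \<or> z = b"
    and simple: "eval_fps (fps_XD F) a \<noteq> 0" "eval_fps (fps_XD F) b \<noteq> 0"
  shows "conv_radius (fps_nth (inverse F)) = ereal (norm a)"
    and "(\<lambda>n. fps_nth (inverse F) n * a ^ n + 1 / eval_fps (fps_XD F) a
              + 1 / eval_fps (fps_XD F) b * (a / b) ^ n) \<longlonglongrightarrow> 0"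
proof -
  define \<theta> where "\<theta> = eval_fps (fps_XD F)"
  define \<beta> where "\<beta> = fps_nth (inverse F)"
  have b0: "b \<noteq> 0" using ab by auto
  obtain R0 where R0: "norm a < R0" "ereal R0 < fps_conv_radius F"
    using ereal_dense2[OF R] by auto
  have th: "\<theta> z = z * deriv (eval_fps F) z" if "norm z = norm a" for z
  proof -
    have z: "ereal (norm z) < fps_conv_radius F" using R that by simp
    hence "eval_fps (fps_XD F) z = z * eval_fps (fps_deriv F) z"
      using fps_conv_radius_deriv[of F] by (simp add: fps_XD_def eval_fps_mult less_le_trans)
    moreover have "deriv (eval_fps F) z = eval_fps (fps_deriv F) z"
      using z by (intro DERIV_imp_deriv has_field_derivative_eval_fps)
    ultimately show ?thesis by (simp add: \<theta>_def)
  qed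
  have "eval_fps F holomorphic_on ball 0 R0"
    using less_trans[OF _ R0(2)] by (intro holomorphic_on_eval_fps) auto
  then obtain r' g where g: "norm a < r'" "g holomorphic_on ball 0 r'"
    "\<And>z. norm z < r' \<Longrightarrow> z \<noteq> a \<Longrightarrow> z \<noteq> b \<Longrightarrow>
        1 / eval_fps F z = 1 / deriv (eval_fps F) a / (z - a) + 1 / deriv (eval_fps F) b / (z - b) + g z"
    by (rule factor_two_simple_zeros[OF _ R0(1) ab(2)]) (use ab(1) zeros simple th in \<open>auto simp: \<theta>_def\<close>)
  have r'0: "r' > 0" using g(1) norm_ge_zero le_less_trans by blast
  define G where "G = fps_expansion g 0"
  have G: "g has_fps_expansion G"
    unfolding G_def using g r'0 by (intro has_fps_expansion_fps_expansion[of "ball 0 r'"]) auto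
  have Grad: "fps_conv_radius G \<ge> ereal r'"
    unfolding G_def using g(2) by (intro conv_radius_fps_expansion) auto
  define P where "P = (\<lambda>q. Abs_fps (\<lambda>n. - (1 / \<theta> q) * (1 / q) ^ n))"
  have "eval_fps F 0 \<noteq> 0" using zeros[of 0] ab(3) b0 by auto
  hence F0: "fps_nth F 0 \<noteq> 0" by (simp add: eval_fps_at_0)
  have "eval_fps F has_fps_expansion F"
    using R by (intro eval_fps_has_fps_expansion) (metis ereal_less_eq(3) le_less_trans norm_ge_zero zero_ereal_def)
  hence inv: "(\<lambda>z. inverse (eval_fps F z)) has_fps_expansion inverse F"
    using F0 by (rule has_fps_expansion_inverse)
  have pole: "(\<lambda>z. 1 / deriv (eval_fps F) q / (z - q)) has_fps_expansion P q"
    if "q \<in> {a, b}" for q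
    using has_fps_expansion_simple_pole[of q "1 / deriv (eval_fps F) q"] that th[of q] ab b0
    by (auto simp: P_def mult_ac)
  have "(\<lambda>z. 1 / deriv (eval_fps F) a / (z - a) + 1 / deriv (eval_fps F) b / (z - b) + g z)
           has_fps_expansion (P a + P b + G)"
    by (intro has_fps_expansion_add pole G) auto
  moreover have "eventually (\<lambda>z. z \<in> ball 0 (norm a)) (nhds 0)"
    using ab by (intro eventually_nhds_in_open) auto
  hence "eventually (\<lambda>z. 1 / deriv (eval_fps F) a / (z - a) + 1 / deriv (eval_fps F) b / (z - b) + g z
             = inverse (eval_fps F z)) (nhds 0)"
  proof eventually_elim
    case (elim z)
    hence "z \<noteq> a" "z \<noteq> b" "norm z < r'" using ab(1) g(1) by auto
    thus ?case using g(3)[of z] by (simp add: inverse_eq_divide)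
  qed
  ultimately have "(\<lambda>z. inverse (eval_fps F z)) has_fps_expansion (P a + P b + G)"
    unfolding has_fps_expansion_def by (auto elim: eventually_elim2)
  with inv have "inverse F = P a + P b + G"
    by (rule fps_expansion_unique_complex)
  hence beta: "\<beta> n = - (1 / \<theta> a) * (1 / a) ^ n - (1 / \<theta> b) * (1 / b) ^ n + fps_nth G n" for n
    by (simp add: \<beta>_def P_def)
  have Gsum: "summable (\<lambda>n. fps_nth G n * z ^ n)" if "norm z < r'" for z
    using that Grad by (intro summable_fps) (metis ereal_less(2) less_le_trans ereal_less_eq(3) less_ereal.simps(1))
  have "(\<lambda>n. fps_nth G n * a ^ n) \<longlonglongrightarrow> 0"
    by (intro summable_LIMSEQ_zero Gsum g(1))
  moreover have "(\<lambda>n. fps_nth G n * a ^ n) = (\<lambda>n. \<beta> n * a ^ n + 1 / \<theta> a + 1 / \<theta> b * (a / b) ^ n)"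
  proof
    fix n
    have 1: "(1 / a) ^ n * a ^ n = 1" "(1 / b) ^ n * a ^ n = (a / b) ^ n"
      using ab by (simp_all add: power_mult_distrib [symmetric])
    have "\<beta> n * a ^ n = - (1 / \<theta> a) * ((1 / a) ^ n * a ^ n) - (1 / \<theta> b) * ((1 / b) ^ n * a ^ n)
             + fps_nth G n * a ^ n"
      unfolding beta by (simp only: distrib_right left_diff_distrib mult.assoc)
    thus "fps_nth G n * a ^ n = \<beta> n * a ^ n + 1 / \<theta> a + 1 / \<theta> b * (a / b) ^ n"
      unfolding 1 by simp
  qed
  ultimately have lim: "(\<lambda>n. \<beta> n * a ^ n + 1 / \<theta> a + 1 / \<theta> b * (a / b) ^ n) \<longlonglongrightarrow> 0"
    by simp
  thus "(\<lambda>n. fps_nth (inverse F) n * a ^ n + 1 / eval_fps (fps_XD F) a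
              + 1 / eval_fps (fps_XD F) b * (a / b) ^ n) \<longlonglongrightarrow> 0"
    by (simp add: \<beta>_def \<theta>_def)
  have "conv_radius \<beta> \<ge> ereal (norm a)"
  proof (rule conv_radius_geI_ex')
    fix s :: real assume s: "0 < s" "ereal s < ereal (norm a)"
    have "summable (\<lambda>n. - (1 / \<theta> q) * (of_real s / q) ^ n)" if "q \<in> {a, b}" for q
      using that s ab by (intro summable_mult summable_geometric) (auto simp: norm_divide)
    hence "summable (\<lambda>n. - (1 / \<theta> a) * (of_real s / a) ^ n + - (1 / \<theta> b) * (of_real s / b) ^ n
              + fps_nth G n * of_real s ^ n)"
      using s g(1) by (intro summable_add Gsum) auto
    moreover have "\<beta> n * of_real s ^ n = - (1 / \<theta> a) * (of_real s / a) ^ n + - (1 / \<theta> b) * (of_real s / b) ^ n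
              + fps_nth G n * of_real s ^ n" for n
    proof -
      have "(of_real s / q) ^ n = (1 / q) ^ n * of_real s ^ n" for q :: complex
        by (simp add: power_mult_distrib [symmetric])
      thus ?thesis unfolding beta by (simp add: algebra_simps)
    qed
    ultimately show "summable (\<lambda>n. \<beta> n * of_real s ^ n)" by simp
  qed
  \<comment> \<open>A larger radius would make \<open>\<beta> n * a ^ n\<close> tend to 0, and then
    the two polar terms alone would have to cancel in the limit.\<close>
  moreover have "conv_radius \<beta> \<le> ereal (norm a)"
  proof (rule ccontr)
    assume "\<not> conv_radius \<beta> \<le> ereal (norm a)"
    hence "summable (\<lambda>n. \<beta> n * a ^ n)" by (intro summable_in_conv_radius) auto
    hence "(\<lambda>n. \<beta> n * a ^ n) \<longlonglongrightarrow> 0" by (rule summable_LIMSEQ_zero)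
    from tendsto_diff[OF lim this]
    have "(\<lambda>n. 1 / \<theta> a + 1 / \<theta> b * (a / b) ^ n) \<longlonglongrightarrow> 0" by (simp add: algebra_simps)
    hence "1 / \<theta> b = 0"
      by (rule rotation_power_tendsto_0_imp) (use ab b0 in \<open>auto simp: norm_divide\<close>)
    thus False using simple by (simp add: \<theta>_def)
  qed
  ultimately show "conv_radius (fps_nth (inverse F)) = ereal (norm a)"
    by (simp add: \<beta>_def)
qed

section \<open>Zeros of maximal imaginary part\<close>

lemma norm_less_fps_conv_radius_eisenstein:
  assumes "k \<ge> 2" "norm q < 1"
  shows "ereal (norm q) < fps_conv_radius (eisenstein_fps k)"
proof -
  have "ereal (norm q) < 1" using assms(2) by simp
  thus ?thesis using fps_conv_radius_eisenstein[OF assms(1)] by (rule less_le_trans)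
qed

text \<open>Reflection handles negative real parts. Inverting a zero inside the unit disc would give
  a strictly higher one outside it; the height bound yields \<open>norm w ^ 2 \<ge> 0.88\<close> and
  \<open>\<bar>Re w\<bar> \<le> 0.4\<close>, so a single inversion stays in the strip.\<close>

lemma eisenstein_top_zeros:
  assumes n: "n \<ge> 3" and E0: "eisenstein_E (4 * n) z0 = 0"
    and uniq: "\<And>w. eisenstein_E (4 * n) w = 0 \<Longrightarrow> norm w \<ge> 1 \<Longrightarrow> 0 \<le> Re w \<Longrightarrow> Re w \<le> 1 / 2 \<Longrightarrow>
        Im w \<ge> cos (pi / (3 * real n)) \<Longrightarrow> w = z0"
    and z0: "Im z0 \<ge> cos (pi / (3 * real n))"
    and w: "eisenstein_E (4 * n) w = 0" "\<bar>Re w\<bar> \<le> 1 / 2" "Im w \<ge> Im z0"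
  shows "w = z0 \<or> w = - cnj z0"
proof -
  have refl: "eisenstein_E (4 * n) (- cnj v) = 0" if "eisenstein_E (4 * n) v = 0" "Im v > 0" for v
    using that n by (subst eisenstein_E_minus_cnj) auto
  have Im0: "Im z0 \<ge> 93906 / 100000" using z0 cos_pi_3n_ge(2)[OF n] by simp
  have uniq': "v = z0 \<or> v = - cnj z0"
    if v: "eisenstein_E (4 * n) v = 0" "norm v \<ge> 1" "\<bar>Re v\<bar> \<le> 1 / 2" "Im v \<ge> Im z0" for v
  proof (cases "Re v \<ge> 0")
    case True
    thus ?thesis using uniq[of v] v z0 by auto
  next
    case False
    hence "- cnj v = z0" using v z0 refl[of v] Im0 by (intro uniq) auto
    thus ?thesis by auto
  qed
  show ?thesis
  proof (cases "norm w \<ge> 1")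
    case True
    thus ?thesis using uniq' w by blast
  next
    case False
    define v where "v = -1 / w"
    have Imw: "Im w \<ge> 93906 / 100000" using Im0 w(3) by simp
    hence w0: "w \<noteq> 0" by auto
    have sq: "norm w ^ 2 = Re w ^ 2 + Im w ^ 2" by (rule cmod_power2)
    have lt: "norm w ^ 2 < 1" using False by (simp add: power_less_one_iff)
    have "Im w ^ 2 \<ge> (93906 / 100000) ^ 2" using Imw by (intro power_mono) auto
    hence ge: "Im w ^ 2 \<ge> 88 / 100" by (simp add: power_divide)
    have v: "Re v = - Re w / norm w ^ 2" "Im v = Im w / norm w ^ 2"
      by (simp_all add: v_def Re_divide Im_divide sq)
    have Imv: "Im v > Im w"
    proof -
      have "Im w * norm w ^ 2 < Im w * 1" using lt Imw by (intro mult_strict_left_mono) auto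
      thus ?thesis using w0 by (simp add: v field_simps)
    qed
    have "\<bar>Re w\<bar> \<le> 4 / 10"
      by (rule power2_le_imp_le) (use lt ge sq in \<open>auto simp: power_divide\<close>)
    moreover have "norm w ^ 2 \<ge> 88 / 100" unfolding sq using ge zero_le_power2[of "Re w"] by linarith
    ultimately have "\<bar>Re w\<bar> \<le> 1 / 2 * norm w ^ 2" by linarith
    hence Rev: "\<bar>Re v\<bar> \<le> 1 / 2" using w0 by (simp add: v abs_divide field_simps)
    have "eisenstein_E (4 * n) v = 0"
      unfolding v_def using n Imw w(1) by (subst eisenstein_E_inversion) auto
    moreover have "norm v \<ge> 1" using False w0 by (simp add: v_def norm_divide field_simps)
    ultimately have "v = z0 \<or> v = - cnj z0" using Rev Imv w(3) by (intro uniq') auto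
    hence "Im v = Im z0" by auto
    thus ?thesis using Imv w(3) by simp
  qed
qed

lemma nome_surj:
  assumes "q \<noteq> 0"
  obtains w where "q = nome w" "\<bar>Re w\<bar> \<le> 1 / 2"
proof
  define w where "w = Ln q / (2 * of_real pi * \<i>)"
  show "q = nome w" using assms by (simp add: nome_def w_def)
  have "w = - \<i> * Ln q / of_real (2 * pi)" by (simp add: w_def divide_simps)
  hence "Re w = Im (Ln q) / (2 * pi)" by (simp only: Re_divide_of_real) simp
  moreover have "\<bar>Im (Ln q)\<bar> \<le> pi"
    using mpi_less_Im_Ln[OF assms] Im_Ln_le_pi[OF assms] by linarith
  hence "\<bar>Im (Ln q)\<bar> / (2 * pi) \<le> pi / (2 * pi)" by (intro divide_right_mono) auto
  ultimately show "\<bar>Re w\<bar> \<le> 1 / 2" by simp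
qed

theorem theorem4:
  fixes k :: nat and z :: complex
  assumes "k \<ge> 12" and "k mod 4 = 0"
    and "is_arg_max Im (\<lambda>w. w \<in> std_fund_domain \<and> eisenstein_E k w = 0) z"
  shows "conv_radius (beta_coeff k) = ereal (norm (nome z)) \<and>
    (\<lambda>n. beta_coeff k n * nome z ^ n
        + 1 / theta_eisenstein k (nome z)
        + 1 / theta_eisenstein k (cnj (nome z)) * (nome z / cnj (nome z)) ^ n)
      \<longlonglongrightarrow> 0"
proof -
  define n where "n = k div 4"
  have k: "k = 4 * n" and n: "n \<ge> 3" and k2: "k \<ge> 2" using assms(1,2) by (auto simp: n_def)
  obtain z0 where z0: "norm z0 = 1" "0 < Re z0" "Re z0 < 1 / 2" "Im z0 \<ge> cos (pi / (3 * real n))"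
    "eisenstein_E k z0 = 0" "theta_eisenstein k (nome z0) \<noteq> 0"
    and uniq: "\<And>w. eisenstein_E k w = 0 \<Longrightarrow> norm w \<ge> 1 \<Longrightarrow> 0 \<le> Re w \<Longrightarrow> Re w \<le> 1 / 2 \<Longrightarrow>
        Im w \<ge> cos (pi / (3 * real n)) \<Longrightarrow> w = z0"
    using eisenstein_zero_on_arc[OF n] unfolding k by blast
  note top = eisenstein_top_zeros[OF n, folded k, OF z0(5) uniq z0(4)]
  have Im0: "Im z0 > 0" using z0(4) cos_pi_3n_ge(2)[OF n] by simp
  define q where "q = nome z0"
  have q1: "norm q < 1" unfolding q_def using Im0 by (rule norm_nome_less_1)
  have "z0 \<in> std_fund_domain" using z0 Im0 by (auto simp: std_fund_domain_def)
  hence z: "eisenstein_E k z = 0" "Im z0 \<le> Im z" "z \<in> std_fund_domain"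
    using assms(3) z0(5) by (auto simp: is_arg_max_def not_less)
  hence "z = z0 \<or> z = - cnj z0"
    by (intro top) (auto simp: std_fund_domain_def)
  hence nz: "nome z = q \<or> nome z = cnj q"
    by (auto simp: q_def nome_minus_cnj)
  have real_coeffs: "fps_nth (fps_XD (eisenstein_fps k)) m \<in> \<real>" for m
    using eisenstein_fps_nth_Reals by simp
  have "ereal (norm q) < fps_conv_radius (fps_XD (eisenstein_fps k))"
    using norm_less_fps_conv_radius_eisenstein[OF k2 q1] fps_conv_radius_XD by (rule less_le_trans)
  hence "theta_eisenstein k (cnj q) = cnj (theta_eisenstein k q)"
    unfolding theta_eisenstein_def by (intro eval_fps_cnj real_coeffs)
  hence theta: "theta_eisenstein k q \<noteq> 0" "theta_eisenstein k (cnj q) \<noteq> 0"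
    using z0(6) by (simp_all add: q_def)
  \<comment> \<open>Because \<open>0 < Re z0 < 1 / 2\<close>, q is not real, so q and its conjugate
    are distinct poles.\<close>
  have "sin (2 * pi * Re z0) > 0"
    using z0 by (intro sin_gt_zero) auto
  hence "Im q \<noteq> 0" by (simp add: q_def nome_def Im_exp mult_ac)
  hence ne: "q \<noteq> cnj q" by (metis complex_cnj_cancel_iff cnj.simps(2) equation_minus_iff neg_equal_zero)
  have zeros: "eval_fps (eisenstein_fps k) y = 0 \<longleftrightarrow> y = q \<or> y = cnj q" if y: "norm y \<le> norm q" for y
  proof
    assume "y = q \<or> y = cnj q"
    moreover have "eval_fps (eisenstein_fps k) (nome z0) = 0"
      "eval_fps (eisenstein_fps k) (nome (- cnj z0)) = 0"
      using z0(5) eisenstein_E_minus_cnj[OF k2 Im0] by (simp_all add: eisenstein_E_def)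
    ultimately show "eval_fps (eisenstein_fps k) y = 0"
      by (auto simp: q_def nome_minus_cnj)
  next
    assume zero: "eval_fps (eisenstein_fps k) y = 0"
    hence "y \<noteq> 0" by (auto simp: eval_fps_at_0 eisenstein_fps_def)
    then obtain w where w: "y = nome w" "\<bar>Re w\<bar> \<le> 1 / 2" by (rule nome_surj)
    \<comment> \<open>A smaller norm of the nome means a larger imaginary part, so the disc contains
      only zeros at least as high as \<open>z0\<close>.\<close>
    have "Im w \<ge> Im z0"
      using y by (simp add: w(1) q_def norm_nome)
    hence "w = z0 \<or> w = - cnj z0"
      using w zero by (intro top) (auto simp: eisenstein_E_def)
    thus "y = q \<or> y = cnj q" by (auto simp: w(1) q_def nome_minus_cnj)
  qed
  \<comment> \<open>The maximiser z may be either \<open>z0\<close> or its reflection; the pair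
    \<open>a\<close>, \<open>cnj a\<close> is the same set of poles in both cases.\<close>
  define a where "a = nome z"
  have a: "a = q \<or> a = cnj q" "norm a = norm q" using nz by (auto simp: a_def)
  have b: "beta_coeff k = fps_nth (inverse (eisenstein_fps k))"
    by (simp add: fun_eq_iff beta_coeff_def)
  have "ereal (norm a) < fps_conv_radius (eisenstein_fps k)"
    using a q1 by (intro norm_less_fps_conv_radius_eisenstein k2) auto
  moreover have "norm (cnj a) = norm a" "a \<noteq> cnj a" "a \<noteq> 0"
    using ne a(1) by (auto simp: a_def)
  moreover have "eval_fps (eisenstein_fps k) y = 0 \<longleftrightarrow> y = a \<or> y = cnj a" if "norm y \<le> norm a" for y
    using zeros[of y] that a by auto
  moreover have "eval_fps (fps_XD (eisenstein_fps k)) a \<noteq> 0"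
    "eval_fps (fps_XD (eisenstein_fps k)) (cnj a) \<noteq> 0"
    using theta a(1) by (auto simp: theta_eisenstein_def)
  ultimately show ?thesis
    unfolding a_def [symmetric] b theta_eisenstein_def
    by (intro conjI inverse_fps_coeff_two_simple_zeros)
qed

end
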